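(* Let $R=\bigoplus_{\alpha\in\Gamma}R_{\alpha}$ be a graded domain. If $R$ is a gGD domain, then $R$ is a g-treed domain.
   Context: All rings are commutative with identity. $\Gamma$ is a nonzero torsionless commutative cancellative monoid, written additively (torsionless is equivalent to the existence of a total order compatible with the monoid operation), with quotient group $\langle\Gamma\rangle$. A graded domain $R=\bigoplus_{\alpha\in\Gamma}R_\alpha$ is an integral domain graded by $\Gamma$; $H=\bigcup_{\alpha\in\Gamma}(R_\alpha\setminus\{0\})$ is its set of nonzero homogeneous elements. The homogeneous quotient field $R_H$ is graded by $\langle\Gamma\rangle$ via $\deg(a/b)=\deg(a)-\deg(b)$. A homogeneous overring of $R$ is a ring $T$ with $R\subseteq T\subseteq R_H$ and $T=\bigoplus_{\alpha\in\langle\Gamma\rangle}(T\cap(R_H)_\alpha)$; it is a $\langle\Gamma\rangle$-graded domain. An ideal is homogeneous if it is generated by homogeneous elements. For a homogeneous overring $T$ of $R$, the extension $R\subseteq T$ satisfies gGD (graded going-down) if, whenever $P_0\subseteq P$ are homogeneous prime ideals of $R$ and $Q$ is a homogeneous prime ideal of $T$ with $Q\cap R=P$, there is a homogeneous prime ideal $Q_0$ of $T$ with $Q_0\subseteq Q$ and $Q_0\cap R=P_0$. $R$ is a gGD domain if $R\subseteq T$ satisfies gGD for every homogeneous overring $T$ of $R$. $R$ is g-treed if no homogeneous prime ideal of $R$ contains two incomparable (under inclusion) homogeneous prime ideals of $R$. *)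

theory Defs
  imports "HOL-Algebra.Algebraic_Closure_Type"
begin

section \<open>The monoid of degrees and its quotient group\<close>

definition torsionless :: "'g::cancel_comm_monoid_add itself \<Rightarrow> bool" where
  "torsionless _ \<longleftrightarrow>
     (\<forall>(n::nat) (\<alpha>::'g) \<beta>. n > 0 \<and> (\<Sum>i<n. \<alpha>) = (\<Sum>i<n. \<beta>) \<longrightarrow> \<alpha> = \<beta>)"

text \<open>The pair \<open>(\<alpha>, \<beta>)\<close> stands for the formal difference \<open>\<alpha> - \<beta>\<close>.\<close>

definition same_diff :: "'g::cancel_comm_monoid_add \<times> 'g \<Rightarrow> 'g \<times> 'g \<Rightarrow> bool" where
  "same_diff p q \<longleftrightarrow> fst p + snd q = fst q + snd p"

lemma same_diff_equivp: "equivp (same_diff :: 'g::cancel_comm_monoid_add \<times> 'g \<Rightarrow> _)"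
proof (rule equivpI)
  show "reflp (same_diff :: 'g \<times> 'g \<Rightarrow> _)"
    by (simp add: reflp_def same_diff_def)
  show "symp (same_diff :: 'g \<times> 'g \<Rightarrow> _)"
    by (auto simp: symp_def same_diff_def)
  show "transp (same_diff :: 'g \<times> 'g \<Rightarrow> _)"
  proof (rule transpI)
    fix p q r :: "'g \<times> 'g"
    assume pq: "same_diff p q" and qr: "same_diff q r"
    have "(fst p + snd r) + snd q = (fst p + snd q) + snd r"
      by (simp only: ac_simps)
    also have "\<dots> = (fst q + snd p) + snd r"
      using pq by (simp only: same_diff_def)
    also have "\<dots> = (fst q + snd r) + snd p"
      by (simp only: ac_simps)
    also have "\<dots> = (fst r + snd q) + snd p"
      using qr by (simp only: same_diff_def)
    also have "\<dots> = (fst r + snd p) + snd q"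
      by (simp only: ac_simps)
    finally show "same_diff p r"
      by (simp add: same_diff_def)
  qed
qed

quotient_type (overloaded) 'g quotient_group = "'g::cancel_comm_monoid_add \<times> 'g" / same_diff
  by (rule same_diff_equivp)

instantiation quotient_group :: (cancel_comm_monoid_add) ab_group_add
begin

lift_definition zero_quotient_group :: "'a quotient_group" is "(0, 0)" .

lift_definition plus_quotient_group ::
    "'a quotient_group \<Rightarrow> 'a quotient_group \<Rightarrow> 'a quotient_group"
  is "\<lambda>p q. (fst p + fst q, snd p + snd q)"
proof -
  fix p p' q q' :: "'a \<times> 'a"
  assume p: "same_diff p p'" and q: "same_diff q q'"
  have "(fst p + fst q) + (snd p' + snd q') = (fst p + snd p') + (fst q + snd q')"
    by (simp only: ac_simps)
  also have "\<dots> = (fst p' + snd p) + (fst q' + snd q)"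
    using p q by (simp only: same_diff_def)
  also have "\<dots> = (fst p' + fst q') + (snd p + snd q)"
    by (simp only: ac_simps)
  finally show "same_diff (fst p + fst q, snd p + snd q) (fst p' + fst q', snd p' + snd q')"
    by (simp only: same_diff_def fst_conv snd_conv)
qed

lift_definition uminus_quotient_group :: "'a quotient_group \<Rightarrow> 'a quotient_group"
  is "\<lambda>p. (snd p, fst p)"
  unfolding same_diff_def fst_conv snd_conv by (simp only: add.commute)

definition minus_quotient_group ::
    "'a quotient_group \<Rightarrow> 'a quotient_group \<Rightarrow> 'a quotient_group" where
  "minus_quotient_group p q = p + - q"

instance
proof
  fix a b c :: "'a quotient_group"
  show "a + b + c = a + (b + c)"
    by transfer (simp add: same_diff_def ac_simps)
  show "a + b = b + a"
    by transfer (simp add: same_diff_def ac_simps)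
  show "0 + a = a"
    by transfer (simp add: same_diff_def)
  show "- a + a = 0"
    by transfer (simp add: same_diff_def ac_simps)
  show "a - b = a + - b"
    by (rule minus_quotient_group_def)
qed

end

lift_definition of_monoid :: "'g::cancel_comm_monoid_add \<Rightarrow> 'g quotient_group"
  is "\<lambda>\<alpha>. (\<alpha>, 0)" .

lemma of_monoid_add: "of_monoid (\<alpha> + \<beta>) = of_monoid \<alpha> + of_monoid \<beta>"
  by transfer (simp add: same_diff_def)

lemma of_monoid_diff_eq_iff:
  "of_monoid \<alpha> - of_monoid \<beta> = of_monoid \<gamma> - of_monoid \<delta> \<longleftrightarrow> \<alpha> + \<delta> = \<gamma> + \<beta>"
  unfolding diff_conv_add_uminus by transfer (simp add: same_diff_def)

lemma of_monoid_inject: "of_monoid \<alpha> = of_monoid \<beta> \<longleftrightarrow> \<alpha> = \<beta>"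
  by transfer (simp add: same_diff_def)

lemma quotient_group_eq_diff: "\<exists>\<alpha> \<beta>. \<delta> = of_monoid \<alpha> - of_monoid \<beta>"
proof -
  have "\<exists>\<alpha> \<beta>. \<delta> = of_monoid \<alpha> + - of_monoid \<beta>"
  proof transfer
    fix p :: "'a \<times> 'a"
    show "\<exists>\<alpha> \<beta>. same_diff p
        (fst (\<alpha>, 0) + fst (snd (\<beta>, 0), fst (\<beta>, 0)), snd (\<alpha>, 0) + snd (snd (\<beta>, 0), fst (\<beta>, 0)))"
      by (intro exI[of _ "fst p"] exI[of _ "snd p"]) (simp add: same_diff_def)
  qed
  then show ?thesis by simp
qed


section \<open>Graded rings and their homogeneous prime ideals\<close>

text \<open>The subset \<open>S\<close> of a ring type as a ring in its own right.\<close>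

abbreviation ring_on :: "'a::comm_ring_1 set \<Rightarrow> 'a ring" where
  "ring_on S \<equiv> ring_of_type_algebra\<lparr>carrier := S\<rparr>"

definition internal_direct_sum ::
    "'a::comm_ring_1 set \<Rightarrow> ('i \<Rightarrow> 'a set) \<Rightarrow> bool" where
  "internal_direct_sum S C \<longleftrightarrow>
     (\<forall>i. additive_subgroup (C i) (ring_on S)) \<and>
     (\<forall>x\<in>S. \<exists>!f. (\<forall>i. f i \<in> C i) \<and> finite {i. f i \<noteq> 0} \<and> x = (\<Sum>i | f i \<noteq> 0. f i))"

text \<open>A graded domain is given by its family \<open>R\<close> of homogeneous components; the underlying
  integral domain is the whole type.\<close>

definition graded_domain :: "('g::cancel_comm_monoid_add \<Rightarrow> 'a::idom set) \<Rightarrow> bool" where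
  "graded_domain R \<longleftrightarrow>
     internal_direct_sum UNIV R \<and>
     (\<forall>\<alpha> \<beta>. \<forall>x\<in>R \<alpha>. \<forall>y\<in>R \<beta>. x * y \<in> R (\<alpha> + \<beta>))"

definition homogeneous_elements :: "('i \<Rightarrow> 'a::zero set) \<Rightarrow> 'a set" where
  "homogeneous_elements C = (\<Union>i. C i - {0})"

definition homogeneous_ideal ::
    "'a::comm_ring_1 set \<Rightarrow> ('i \<Rightarrow> 'a set) \<Rightarrow> 'a set \<Rightarrow> bool" where
  "homogeneous_ideal S C I \<longleftrightarrow>
     (\<exists>G \<subseteq> homogeneous_elements C. I = genideal (ring_on S) G)"

definition homogeneous_prime_ideal ::
    "'a::comm_ring_1 set \<Rightarrow> ('i \<Rightarrow> 'a set) \<Rightarrow> 'a set \<Rightarrow> bool" where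
  "homogeneous_prime_ideal S C P \<longleftrightarrow>
     primeideal P (ring_on S) \<and> homogeneous_ideal S C P"


section \<open>Homogeneous overrings\<close>

definition homogeneous_quotient_field ::
    "('g::cancel_comm_monoid_add \<Rightarrow> 'a::idom set) \<Rightarrow> 'a fract set" where
  "homogeneous_quotient_field R =
     {Fraction_Field.Fract a b | a b. b \<in> homogeneous_elements R}"

text \<open>The zero fraction is inserted explicitly because a degree \<open>\<delta>\<close> need not be the difference
  of two degrees \<open>\<alpha>\<close>, \<open>\<beta>\<close> with \<open>R \<beta> \<noteq> {0}\<close>; the component of such a \<open>\<delta>\<close> is \<open>{0}\<close>, not empty.\<close>

definition quotient_field_component ::
    "('g::cancel_comm_monoid_add \<Rightarrow> 'a::idom set) \<Rightarrow> 'g quotient_group \<Rightarrow> 'a fract set" where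
  "quotient_field_component R \<delta> =
     insert 0 {Fraction_Field.Fract a b | a b. \<exists>\<alpha> \<beta>.
       a \<in> R \<alpha> - {0} \<and> b \<in> R \<beta> - {0} \<and> \<delta> = of_monoid \<alpha> - of_monoid \<beta>}"

definition overring_component ::
    "('g::cancel_comm_monoid_add \<Rightarrow> 'a::idom set) \<Rightarrow> 'a fract set \<Rightarrow>
     'g quotient_group \<Rightarrow> 'a fract set" where
  "overring_component R T \<delta> = T \<inter> quotient_field_component R \<delta>"

definition homogeneous_overring ::
    "('g::cancel_comm_monoid_add \<Rightarrow> 'a::idom set) \<Rightarrow> 'a fract set \<Rightarrow> bool" where
  "homogeneous_overring R T \<longleftrightarrow>
     subring T (ring_of_type_algebra :: 'a fract ring) \<and>
     range to_fract \<subseteq> T \<and> T \<subseteq> homogeneous_quotient_field R \<and>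
     internal_direct_sum T (overring_component R T)"


section \<open>Graded going-down and g-treed domains\<close>

text \<open>As \<open>to_fract\<close> embeds the graded domain into its field of fractions, the contraction
  \<open>Q \<inter> R\<close> is the preimage \<open>to_fract -` Q\<close>.\<close>

definition satisfies_gGD ::
    "('g::cancel_comm_monoid_add \<Rightarrow> 'a::idom set) \<Rightarrow> 'a fract set \<Rightarrow> bool" where
  "satisfies_gGD R T \<longleftrightarrow>
     (\<forall>P\<^sub>0 P Q. homogeneous_prime_ideal UNIV R P\<^sub>0 \<and> homogeneous_prime_ideal UNIV R P \<and> P\<^sub>0 \<subseteq> P \<and>
        homogeneous_prime_ideal T (overring_component R T) Q \<and> to_fract -` Q = P \<longrightarrow>
        (\<exists>Q\<^sub>0. homogeneous_prime_ideal T (overring_component R T) Q\<^sub>0 \<and>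
           Q\<^sub>0 \<subseteq> Q \<and> to_fract -` Q\<^sub>0 = P\<^sub>0))"

definition gGD_domain :: "('g::cancel_comm_monoid_add \<Rightarrow> 'a::idom set) \<Rightarrow> bool" where
  "gGD_domain R \<longleftrightarrow> (\<forall>T. homogeneous_overring R T \<longrightarrow> satisfies_gGD R T)"

definition g_treed :: "('g::cancel_comm_monoid_add \<Rightarrow> 'a::idom set) \<Rightarrow> bool" where
  "g_treed R \<longleftrightarrow>
     \<not> (\<exists>P P\<^sub>1 P\<^sub>2. homogeneous_prime_ideal UNIV R P \<and>
          homogeneous_prime_ideal UNIV R P\<^sub>1 \<and> homogeneous_prime_ideal UNIV R P\<^sub>2 \<and>
          P\<^sub>1 \<subseteq> P \<and> P\<^sub>2 \<subseteq> P \<and> \<not> P\<^sub>1 \<subseteq> P\<^sub>2 \<and> \<not> P\<^sub>2 \<subseteq> P\<^sub>1)"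

end

theory Submission
  imports Defs
begin

text \<open>Suppose that a homogeneous prime \<open>P\<close> contains two incomparable homogeneous primes \<open>P\<^sub>1\<close> and \<open>P\<^sub>2\<close>.
  Since these are generated by homogeneous elements, there are homogeneous \<open>a \<in> P\<^sub>1 - P\<^sub>2\<close> and
  \<open>b \<in> P\<^sub>2 - P\<^sub>1\<close>. Put \<open>w = a / b\<close>, let \<open>S\<close> be the set of homogeneous elements outside \<open>P\<close>, and consider the
  homogeneous overring \<open>T = R\<^sub>S[w]\<close>. If some homogeneous prime \<open>Q\<close> of \<open>T\<close> lies over \<open>P\<close>, then
  going-down gives a prime \<open>Q\<^sub>0\<close> of \<open>T\<close> over \<open>P\<^sub>2\<close>. It contains \<open>b\<close>, hence also \<open>a = w b\<close>, so
  \<open>a \<in> P\<^sub>2\<close>: a contradiction (lemma \<open>going_down_fails\<close>). With \<open>1 / w\<close> the same argument contradicts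
  \<open>b \<notin> P\<^sub>1\<close>. So it is enough to find \<open>Q\<close> for one of the two overrings.

  A homogeneous prime over \<open>P\<close> exists as soon as \<open>P\<close> generates a proper ideal of \<open>R\<^sub>S[w]\<close> (lemma
  \<open>lying_over\<close>). Take any prime ideal above that ideal and keep only the elements all of whose
  homogeneous components belong to it. This homogeneous part is still prime because the degrees lie in a
  torsion-free group, which can be totally ordered (lemmas \<open>torsion_free_total_cone\<close> and
  \<open>homogeneous_part_prime\<close>). It contracts to \<open>P\<close> because the elements of \<open>S\<close> are units.

  It remains to see that \<open>P\<close> cannot generate the unit ideal both in \<open>R\<^sub>S[w]\<close> and in \<open>R\<^sub>S[1 / w]\<close>
  (lemma \<open>survives_in_one_direction\<close>). This is the classical argument for valuation rings, carried out in
  degree \<open>0\<close>. Taking degree-\<open>0\<close> components of the two expressions of \<open>1\<close> yields relations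
  \<open>1 = x\<^sub>0 + \<dots> + x\<^sub>n\<close> and \<open>1 = y\<^sub>0 + \<dots> + y\<^sub>m\<close>, where \<open>x\<^sub>i\<close> is \<open>w\<^sup>i\<close> and \<open>y\<^sub>j\<close> is \<open>w\<close> to the power \<open>- j\<close>,
  each times a homogeneous element of \<open>P R\<^sub>S\<close>. As \<open>1 - y\<^sub>0\<close> is a unit of \<open>R\<^sub>S\<close>, the second relation
  can be used to remove \<open>x\<^sub>n\<close> when \<open>m \<le> n\<close>, and symmetrically; descent on \<open>n + m\<close> ends in \<open>1 \<in> P R\<^sub>S\<close>,
  which is impossible (lemma \<open>no_opposite_relations\<close>).\<close>
section \<open>Additive spans and decompositions\<close>

inductive_set add_span :: "'a::comm_monoid_add set \<Rightarrow> 'a set" for G where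
  zero: "0 \<in> add_span G"
| step: "g \<in> G \<Longrightarrow> x \<in> add_span G \<Longrightarrow> g + x \<in> add_span G"

lemma add_span_base: "g \<in> G \<Longrightarrow> g \<in> add_span G"
  using add_span.step[OF _ add_span.zero, of g G] by simp

lemma add_span_add: "x \<in> add_span G \<Longrightarrow> y \<in> add_span G \<Longrightarrow> x + y \<in> add_span G"
  by (induction rule: add_span.induct) (auto simp: add.assoc intro: add_span.step)

lemma add_span_least:
  assumes "x \<in> add_span G" "G \<subseteq> S" "0 \<in> S" "\<And>x y. x \<in> S \<Longrightarrow> y \<in> S \<Longrightarrow> x + y \<in> S"
  shows "x \<in> S"
  using assms by (induction rule: add_span.induct) auto

lemma add_span_mono: "G \<subseteq> G' \<Longrightarrow> x \<in> add_span G \<Longrightarrow> x \<in> add_span G'"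
  by (erule add_span_least) (auto intro: add_span_base add_span.zero add_span_add)

text \<open>When \<open>B\<close> is closed under addition, all summands from \<open>B\<close> can be collected into one. This is how the
  leading or the constant term of a polynomial expression is split off.\<close>
lemma add_span_Un_closed:
  assumes "x \<in> add_span (A \<union> B)" "0 \<in> B" "\<And>x y. x \<in> B \<Longrightarrow> y \<in> B \<Longrightarrow> x + y \<in> B"
  shows "\<exists>y\<in>add_span A. \<exists>z\<in>B. x = y + z"
  using assms(1)
proof (induction rule: add_span.induct)
  case zero
  show ?case using assms(2) add_span.zero by force
next
  case (step g x)
  then obtain y z where yz: "y \<in> add_span A" "z \<in> B" "x = y + z" by blast
  from step(1) show ?case
  proof
    assume "g \<in> A"
    then show ?thesis using yz add_span.step by (metis add.assoc)
  next
    assume "g \<in> B"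
    then show ?thesis using yz assms(3) by (metis add.left_commute)
  qed
qed

lemma add_span_mult_left:
  fixes c :: "'a::semiring_0"
  assumes "x \<in> add_span G" "\<And>g. g \<in> G \<Longrightarrow> c * g \<in> add_span G'"
  shows "c * x \<in> add_span G'"
  using assms by (induction rule: add_span.induct)
    (auto simp: distrib_left intro: add_span.zero add_span_add)

lemma add_span_mult:
  fixes x :: "'a::semiring_0"
  assumes "x \<in> add_span G" "y \<in> add_span H" "\<And>g h. g \<in> G \<Longrightarrow> h \<in> H \<Longrightarrow> g * h \<in> K"
  shows "x * y \<in> add_span K"
  using assms(1)
proof (induction rule: add_span.induct)
  case (step g x)
  have "g * y \<in> add_span K"
    using assms(2) by (rule add_span_mult_left) (auto intro: add_span_base assms(3) step)
  then show ?case using step by (simp add: distrib_right add_span_add)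
qed (simp add: add_span.zero)

lemma add_span_uminus:
  fixes x :: "'a::ab_group_add"
  assumes "x \<in> add_span G" "\<And>g. g \<in> G \<Longrightarrow> - g \<in> G"
  shows "- x \<in> add_span G"
  using assms(1)
proof (induction rule: add_span.induct)
  case (step g x)
  then have "- g + - x \<in> add_span G" using assms(2) add_span.step by blast
  then show ?case by simp
qed (simp add: add_span.zero)

text \<open>The clause of \<open>internal_direct_sum\<close> that describes \<open>f\<close> as the family of homogeneous components of \<open>x\<close>.\<close>
definition decomposes :: "('i \<Rightarrow> 'a set) \<Rightarrow> ('i \<Rightarrow> 'a::comm_monoid_add) \<Rightarrow> 'a \<Rightarrow> bool" where
  "decomposes C f x \<longleftrightarrow>
     (\<forall>i. f i \<in> C i) \<and> finite {i. f i \<noteq> 0} \<and> x = (\<Sum>i | f i \<noteq> 0. f i)"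

lemma decomposesD:
  assumes "decomposes C f x"
  shows "f i \<in> C i" "finite {i. f i \<noteq> 0}" "x = (\<Sum>i | f i \<noteq> 0. f i)"
  using assms by (auto simp: decomposes_def)

lemma decomposes_superset:
  assumes "decomposes C f x" "finite D" "{i. f i \<noteq> 0} \<subseteq> D"
  shows "x = sum f D"
proof -
  have "sum f D = sum f {i. f i \<noteq> 0}"
    using assms by (intro sum.mono_neutral_right) auto
  with assms(1) show ?thesis by (simp add: decomposes_def)
qed

lemma decomposesI:
  assumes "\<And>i. f i \<in> C i" "finite D" "{i. f i \<noteq> 0} \<subseteq> D" "x = sum f D"
  shows "decomposes C f x"
proof -
  have "sum f D = sum f {i. f i \<noteq> 0}"
    using assms by (intro sum.mono_neutral_right) auto
  with assms show ?thesis by (auto simp: decomposes_def intro: finite_subset)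
qed

locale additive_family =
  fixes C :: "'i \<Rightarrow> 'a::ab_group_add set"
  assumes zero_mem: "0 \<in> C i"
    and add_mem: "x \<in> C i \<Longrightarrow> y \<in> C i \<Longrightarrow> x + y \<in> C i"
    and uminus_mem: "x \<in> C i \<Longrightarrow> - x \<in> C i"
begin

lemma decomposes_zero: "decomposes C (\<lambda>_. 0) 0"
  by (simp add: decomposes_def zero_mem)

lemma decomposes_single:
  assumes "x \<in> C i"
  shows "decomposes C (\<lambda>j. if j = i then x else 0) x"
  using assms by (intro decomposesI[where D = "{i}"]) (auto simp: zero_mem)

lemma decomposes_add:
  assumes "decomposes C f x" "decomposes C g y"
  shows "decomposes C (\<lambda>i. f i + g i) (x + y)"
proof -
  define D where "D = {i. f i \<noteq> 0} \<union> {i. g i \<noteq> 0}"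
  have D: "finite D" using assms by (simp add: D_def decomposesD)
  have "x = sum f D" "y = sum g D"
    using assms D by (auto intro!: decomposes_superset simp: D_def)
  then show ?thesis using D assms
    by (intro decomposesI[where D = D])
      (auto simp: D_def sum.distrib intro!: add_mem dest: decomposesD)
qed

lemma decomposes_sum:
  assumes "\<And>a. a \<in> A \<Longrightarrow> decomposes C (h a) (s a)"
  shows "decomposes C (\<lambda>i. \<Sum>a\<in>A. h a i) (\<Sum>a\<in>A. s a)"
  using assms
  by (induction A rule: infinite_finite_induct)
     (auto intro: decomposes_zero decomposes_add)

text \<open>A group generated by homogeneous elements contains the components of each of its elements.\<close>
lemma decomposes_in_add_span:
  assumes "x \<in> add_span G" "G \<subseteq> (\<Union>i. C i)"
  shows "\<exists>f. decomposes C f x \<and> (\<forall>i. f i \<in> add_span G)"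
  using assms(1)
proof (induction rule: add_span.induct)
  case zero
  show ?case using decomposes_zero add_span.zero by blast
next
  case (step g x)
  then obtain f where f: "decomposes C f x" "\<forall>i. f i \<in> add_span G" by blast
  obtain i where "g \<in> C i" using step assms(2) by blast
  from decomposes_add[OF decomposes_single[OF this] f(1)]
  have "decomposes C (\<lambda>j. (if j = i then g else 0) + f j) (g + x)" .
  moreover have "(if j = i then g else 0) + f j \<in> add_span G" for j
    using f(2) step(1) by (simp add: add_span.step)
  ultimately show ?case by (intro exI[of _ "\<lambda>j. (if j = i then g else 0) + f j"]) blast
qed

end

locale independent_family = additive_family C
  for C :: "'i \<Rightarrow> 'a::ab_group_add set" +
  assumes independent: "finite D \<Longrightarrow> (\<And>i. i \<in> D \<Longrightarrow> f i \<in> C i) \<Longrightarrow> sum f D = 0 \<Longrightarrow>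
    i \<in> D \<Longrightarrow> f i = 0"
begin

lemma decomposes_unique:
  assumes "decomposes C f x" "decomposes C g x"
  shows "f = g"
proof
  fix i
  define D where "D = insert i ({i. f i \<noteq> 0} \<union> {i. g i \<noteq> 0})"
  have D: "finite D" using assms by (simp add: D_def decomposesD)
  have "x = sum f D" "x = sum g D"
    using assms D by (auto intro!: decomposes_superset simp: D_def)
  then have "sum (\<lambda>i. f i + - g i) D = 0" by (simp add: sum_subtractf)
  then have "f i + - g i = 0"
    using D assms by (intro independent[of D "\<lambda>i. f i + - g i"])
      (auto simp: D_def decomposesD intro!: add_mem uminus_mem simp del: add_uminus_conv_diff)
  then show "f i = g i" by simp
qed

text \<open>A nonzero element lying in two components would decompose in two different ways.\<close>
lemma degree_unique:
  assumes "x \<in> C i" "x \<in> C j" "x \<noteq> 0"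
  shows "i = j"
  using decomposes_unique[OF decomposes_single[OF assms(1)] decomposes_single[OF assms(2)]]
    assms(3) by metis

end


section \<open>Ordering a torsion-free abelian group\<close>

definition multiple :: "nat \<Rightarrow> 'd::ab_group_add \<Rightarrow> 'd" where
  "multiple n x = (\<Sum>i<n. x)"

lemma multiple_0 [simp]: "multiple 0 x = 0"
  by (simp add: multiple_def)

lemma multiple_Suc [simp]: "multiple (Suc n) x = x + multiple n x"
  by (simp add: multiple_def add.commute)

lemma multiple_add: "multiple (m + n) x = multiple m x + multiple n x"
  by (induction m) (auto simp: algebra_simps)

lemma multiple_mult: "multiple (m * n) x = multiple m (multiple n x)"
  by (induction m) (auto simp: multiple_add)

lemma multiple_minus: "multiple n (- x) = - multiple n x"
  by (simp add: multiple_def sum_negf)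

text \<open>Cones are the nonnegative parts of the translation-invariant partial orders on the group. The order is
  total when every element or its negative belongs to the cone.\<close>
definition cone :: "'d::ab_group_add set \<Rightarrow> bool" where
  "cone P \<longleftrightarrow> 0 \<in> P \<and> (\<forall>x\<in>P. \<forall>y\<in>P. x + y \<in> P) \<and> (\<forall>x\<in>P. - x \<in> P \<longrightarrow> x = 0)"

lemma cone_multiple: "cone P \<Longrightarrow> x \<in> P \<Longrightarrow> multiple n x \<in> P"
  by (induction n) (auto simp: cone_def)

text \<open>Adjoining the multiples of \<open>x\<close> to \<open>P\<close> cannot give a cone, by maximality; this failure forces a negative
  multiple of \<open>x\<close> to lie in \<open>P\<close>.\<close>
lemma maximal_cone_escape:
  assumes P: "cone P" and max: "\<And>U. cone U \<Longrightarrow> P \<subseteq> U \<Longrightarrow> U = P" and x: "x \<notin> P"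
  shows "\<exists>k>0. - multiple k x \<in> P"
proof -
  define P' where "P' = {p + multiple n x | p n. p \<in> P}"
  have "P \<subseteq> P'"
    unfolding P'_def by (force intro: exI[of _ 0])
  moreover have "x \<in> P'"
    unfolding P'_def using P by (auto simp: cone_def intro!: exI[of _ 0] exI[of _ "Suc 0"])
  ultimately have nc: "\<not> cone P'"
    using max x by blast
  have "0 \<in> P'" using \<open>P \<subseteq> P'\<close> P by (auto simp: cone_def)
  moreover have "y + z \<in> P'" if "y \<in> P'" "z \<in> P'" for y z
  proof -
    from that obtain p m q n where "y = p + multiple m x" "z = q + multiple n x" "p \<in> P" "q \<in> P"
      by (auto simp: P'_def)
    then have "y + z = (p + q) + multiple (m + n) x" "p + q \<in> P"
      using P by (auto simp: multiple_add cone_def algebra_simps)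
    then show ?thesis by (auto simp: P'_def)
  qed
  ultimately obtain y where y: "y \<in> P'" "- y \<in> P'" "y \<noteq> 0"
    using nc by (auto simp: cone_def)
  then obtain p m q n where pq: "y = p + multiple m x" "- y = q + multiple n x" "p \<in> P" "q \<in> P"
    by (auto simp: P'_def)
  have "(p + multiple m x) + (q + multiple n x) = 0"
    using pq(1,2) by (metis add.right_inverse)
  then have "(p + q) + multiple (m + n) x = 0"
    by (simp add: multiple_add ac_simps)
  then have eq: "- multiple (m + n) x = p + q"
    by (metis add_eq_0_iff minus_minus)
  have "m + n > 0"
  proof (rule ccontr)
    assume "\<not> m + n > 0"
    then have "y = p" "- y = q" using pq by auto
    then show False using P pq y by (auto simp: cone_def)
  qed
  moreover have "p + q \<in> P" using P pq by (auto simp: cone_def)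
  ultimately show ?thesis using eq by metis
qed

text \<open>If a maximal cone contained neither \<open>x\<close> nor \<open>- x\<close>, it would contain a negative multiple \<open>- k x\<close> and,
  likewise, a positive multiple \<open>l x\<close>. Then \<open>k l x\<close> and \<open>- k l x\<close> would both belong to it, so \<open>k l x = 0\<close>,
  which torsion-freeness excludes.\<close>
lemma torsion_free_total_cone:
  assumes tf: "\<And>n (x::'d::ab_group_add). n > 0 \<Longrightarrow> multiple n x = 0 \<Longrightarrow> x = 0"
  obtains P :: "'d::ab_group_add set" where "cone P" "\<And>x. x \<in> P \<or> - x \<in> P"
proof -
  have "\<exists>M\<in>Collect cone. \<forall>U\<in>Collect cone. M \<subseteq> U \<longrightarrow> U = (M :: 'd set)"
  proof (rule subset_Zorn_nonempty)
    show "Collect cone \<noteq> ({} :: 'd set set)"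
      by (auto simp: cone_def intro!: exI[of _ "{0}"])
  next
    fix \<C> :: "'d set set"
    assume ne: "\<C> \<noteq> {}" and ch: "subset.chain (Collect cone) \<C>"
    have c: "cone U" if "U \<in> \<C>" for U using ch that by (auto simp: subset.chain_def)
    have common: "\<exists>U\<in>\<C>. x \<in> U \<and> y \<in> U" if "x \<in> \<Union>\<C>" "y \<in> \<Union>\<C>" for x y
    proof -
      from that obtain U V where "U \<in> \<C>" "V \<in> \<C>" "x \<in> U" "y \<in> V" by blast
      moreover from this have "U \<subseteq> V \<or> V \<subseteq> U" using ch by (auto simp: subset_chain_def)
      ultimately show ?thesis by blast
    qed
    show "\<Union>\<C> \<in> Collect cone"
      unfolding mem_Collect_eq cone_def
    proof (intro conjI ballI impI)
      show "0 \<in> \<Union>\<C>" using ne c by (auto simp: cone_def)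
    next
      fix x y assume "x \<in> \<Union>\<C>" "y \<in> \<Union>\<C>"
      then show "x + y \<in> \<Union>\<C>" using common[of x y] c by (auto simp: cone_def)
    next
      fix x assume "x \<in> \<Union>\<C>" "- x \<in> \<Union>\<C>"
      then show "x = 0" using common[of x "- x"] c by (auto simp: cone_def)
    qed
  qed
  then obtain P :: "'d set" where P: "cone P" "\<And>U. cone U \<Longrightarrow> P \<subseteq> U \<Longrightarrow> U = P" by blast
  have "x \<in> P \<or> - x \<in> P" for x
  proof (rule ccontr)
    assume "\<not> (x \<in> P \<or> - x \<in> P)"
    then obtain k l where k: "k > 0" "- multiple k x \<in> P" and l: "l > 0" "- multiple l (- x) \<in> P"
      using maximal_cone_escape[OF P] by meson
    have "- multiple (l * k) x \<in> P"
      using cone_multiple[OF P(1) k(2), of l] by (simp add: multiple_mult multiple_minus)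
    moreover have "multiple (l * k) x \<in> P"
      using cone_multiple[OF P(1) l(2), of k]
      by (simp add: multiple_mult[symmetric] multiple_minus mult.commute)
    ultimately have "multiple (l * k) x = 0" using P(1) by (auto simp: cone_def)
    then have "x = 0" using tf[of "l * k" x] k l by simp
    then show False using \<open>\<not> _\<close> P(1) by (auto simp: cone_def)
  qed
  with P(1) that show thesis by blast
qed

lemma total_cone_maximum:
  assumes "finite A" "A \<noteq> {}" "cone P" "\<And>x. x \<in> P \<or> - x \<in> P"
  shows "\<exists>m\<in>A. \<forall>a\<in>A. m - a \<in> P"
  using assms(1,2)
proof (induction rule: finite_ne_induct)
  case (singleton x)
  then show ?case using assms(3) by (simp add: cone_def)
next
  case (insert x A)
  then obtain m where m: "m \<in> A" "\<And>a. a \<in> A \<Longrightarrow> m - a \<in> P" by blast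
  show ?case
  proof (cases "m - x \<in> P")
    case True
    then show ?thesis using m by blast
  next
    case False
    then have xm: "x - m \<in> P" using assms(4)[of "m - x"] by simp
    have "x - a \<in> P" if "a \<in> A" for a
    proof -
      have "(x - m) + (m - a) \<in> P" using xm m(2)[OF that] assms(3) unfolding cone_def by blast
      then show ?thesis by simp
    qed
    moreover have "x - x \<in> P" using assms(3) by (simp add: cone_def)
    ultimately show ?thesis by blast
  qed
qed


section \<open>Ideals of subrings of a type\<close>

text \<open>Subrings and ideals as sets with the operations of the ambient type. The lemmas on \<open>ring_on\<close> below
  identify these notions with those of carrier-based rings, so that arguments on elements need not mention
  carriers.\<close>
definition subring_set :: "'a::comm_ring_1 set \<Rightarrow> bool" where
  "subring_set T \<longleftrightarrow> 1 \<in> T \<and> (\<forall>x\<in>T. - x \<in> T) \<and> (\<forall>x\<in>T. \<forall>y\<in>T. x + y \<in> T \<and> x * y \<in> T)"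

definition ideal_set :: "'a::comm_ring_1 set \<Rightarrow> 'a set \<Rightarrow> bool" where
  "ideal_set T I \<longleftrightarrow>
     I \<subseteq> T \<and> 0 \<in> I \<and> (\<forall>x\<in>I. \<forall>y\<in>I. x + y \<in> I) \<and> (\<forall>t\<in>T. \<forall>x\<in>I. t * x \<in> I)"

definition prime_ideal_set :: "'a::comm_ring_1 set \<Rightarrow> 'a set \<Rightarrow> bool" where
  "prime_ideal_set T P \<longleftrightarrow>
     ideal_set T P \<and> 1 \<notin> P \<and> (\<forall>x\<in>T. \<forall>y\<in>T. x * y \<in> P \<longrightarrow> x \<in> P \<or> y \<in> P)"

lemma subring_set_UNIV: "subring_set UNIV"
  by (simp add: subring_set_def)

lemma ideal_set_UNIV: "ideal_set UNIV UNIV"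
  by (simp add: ideal_set_def)

lemma subring_set_zero:
  assumes "subring_set T"
  shows "0 \<in> T"
proof -
  have "1 + - 1 \<in> T" using assms unfolding subring_set_def by blast
  then show ?thesis by simp
qed

lemma ideal_set_uminus:
  assumes "subring_set T" "ideal_set T I" "x \<in> I"
  shows "- x \<in> I"
proof -
  have "- 1 * x \<in> I" using assms unfolding subring_set_def ideal_set_def by blast
  then show ?thesis by simp
qed

lemma ideal_set_sum:
  "ideal_set T I \<Longrightarrow> (\<And>a. a \<in> A \<Longrightarrow> f a \<in> I) \<Longrightarrow> sum f A \<in> I"
  by (induction A rule: infinite_finite_induct) (auto simp: ideal_set_def)

lemma ring_on_simps [simp]:
  "carrier (ring_on T) = T" "monoid.mult (ring_on T) = (*)" "one (ring_on T) = 1"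
  "ring.zero (ring_on T) = 0" "add (ring_on T) = (+)"
  by (simp_all add: ring_of_type_algebra_def fun_eq_iff)

lemma cring_ring_on:
  assumes "subring_set T"
  shows "cring (ring_on T)"
proof (rule cringI)
  show "abelian_group (ring_on T)"
  proof (rule abelian_groupI)
    fix x assume "x \<in> carrier (ring_on T)"
    then show "\<exists>y\<in>carrier (ring_on T). y \<oplus>\<^bsub>ring_on T\<^esub> x = \<zero>\<^bsub>ring_on T\<^esub>"
      using assms by (intro bexI[of _ "- x"]) (auto simp: subring_set_def)
  qed (use assms subring_set_zero[OF assms] in \<open>auto simp: subring_set_def ac_simps\<close>)
  show "comm_monoid (ring_on T)"
    by (rule comm_monoidI) (use assms in \<open>auto simp: subring_set_def ac_simps\<close>)
qed (auto simp: distrib_right)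

lemma a_inv_ring_on:
  assumes "subring_set T" "x \<in> T"
  shows "\<ominus>\<^bsub>ring_on T\<^esub> x = - x"
proof -
  interpret cring "ring_on T" by (rule cring_ring_on) fact
  show ?thesis by (rule minus_equality) (use assms in \<open>auto simp: subring_set_def\<close>)
qed

lemma additive_subgroup_ring_on_iff:
  assumes "subring_set T"
  shows "additive_subgroup I (ring_on T) \<longleftrightarrow>
    I \<subseteq> T \<and> 0 \<in> I \<and> (\<forall>x\<in>I. \<forall>y\<in>I. x + y \<in> I) \<and> (\<forall>x\<in>I. - x \<in> I)"
    (is "?l \<longleftrightarrow> ?r")
proof -
  interpret cring "ring_on T" by (rule cring_ring_on) fact
  note inv = a_inv_ring_on[OF assms, unfolded a_inv_def]
  show ?thesis
  proof
    assume ?l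
    then interpret additive_subgroup I "ring_on T" .
    have "I \<subseteq> T" using a_subset by simp
    moreover have "- x \<in> I" if "x \<in> I" for x
    proof -
      have xT: "x \<in> T" using that \<open>I \<subseteq> T\<close> by blast
      from subgroup.m_inv_closed[OF a_subgroup that] show ?thesis
        unfolding inv[OF xT] .
    qed
    ultimately show ?r using a_closed zero_closed by auto
  next
    assume r: ?r
    show ?l
    proof (rule additive_subgroupI, rule subgroup.intro)
      fix x assume "x \<in> I"
      then show "inv\<^bsub>add_monoid (ring_on T)\<^esub> x \<in> I" using r inv[of x] by auto
    qed (use r in auto)
  qed
qed

lemma ideal_ring_on_iff:
  assumes "subring_set T"
  shows "ideal I (ring_on T) \<longleftrightarrow> ideal_set T I"
proof
  interpret cring "ring_on T" by (rule cring_ring_on) fact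
  {
    assume "ideal I (ring_on T)"
    then interpret ideal I "ring_on T" .
    have "additive_subgroup I (ring_on T)" ..
    then show "ideal_set T I"
      using additive_subgroup_ring_on_iff[OF assms, of I] I_l_closed by (auto simp: ideal_set_def)
  next
    assume i: "ideal_set T I"
    then have "additive_subgroup I (ring_on T)"
      unfolding additive_subgroup_ring_on_iff[OF assms]
      using ideal_set_uminus[OF assms i] by (auto simp: ideal_set_def)
    moreover have l: "x * a \<in> I" if "a \<in> I" "x \<in> T" for a x
      using i that by (auto simp: ideal_set_def)
    moreover have "a * x \<in> I" if "a \<in> I" "x \<in> T" for a x
      using l[OF that] by (simp add: mult.commute)
    ultimately show "ideal I (ring_on T)"
      by (intro idealI ring_axioms) (auto simp: additive_subgroup_def)
  }
qed

lemma primeideal_ring_on_iff: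
  assumes "subring_set T"
  shows "primeideal P (ring_on T) \<longleftrightarrow> prime_ideal_set T P"
proof
  interpret cring "ring_on T" by (rule cring_ring_on) fact
  {
    assume "primeideal P (ring_on T)"
    then interpret primeideal P "ring_on T" .
    have "ideal P (ring_on T)" ..
    then show "prime_ideal_set T P"
      using ideal_ring_on_iff[OF assms, of P] I_prime I_notcarr one_imp_carrier
      by (auto simp: prime_ideal_set_def)
  next
    assume p: "prime_ideal_set T P"
    then have "ideal P (ring_on T)"
      using ideal_ring_on_iff[OF assms, of P] by (simp add: prime_ideal_set_def)
    moreover have "1 \<in> T" using assms by (simp add: subring_set_def)
    ultimately show "primeideal P (ring_on T)"
      using p by (intro primeidealI is_cring) (auto simp: prime_ideal_set_def)
  }
qed

text \<open>Zorn's lemma gives an ideal \<open>Q\<close> that is maximal among the proper ideals above \<open>J\<close>; the usual argument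
  shows that it is prime.\<close>
lemma prime_ideal_above:
  assumes T: "subring_set T" and J: "ideal_set T J" "1 \<notin> J"
  obtains Q where "prime_ideal_set T Q" "J \<subseteq> Q"
proof -
  define F where "F = {I. ideal_set T I \<and> J \<subseteq> I \<and> 1 \<notin> I}"
  have "\<exists>M\<in>F. \<forall>I\<in>F. M \<subseteq> I \<longrightarrow> I = M"
  proof (rule subset_Zorn_nonempty)
    show "F \<noteq> {}" using J by (auto simp: F_def)
  next
    fix \<C> assume ne: "\<C> \<noteq> {}" and ch: "subset.chain F \<C>"
    have c: "ideal_set T I" "J \<subseteq> I" "1 \<notin> I" if "I \<in> \<C>" for I
      using ch that by (auto simp: subset_chain_def F_def)
    have "x + y \<in> \<Union>\<C>" if xy: "x \<in> \<Union>\<C>" "y \<in> \<Union>\<C>" for x y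
    proof -
      from xy obtain U V where "U \<in> \<C>" "V \<in> \<C>" "x \<in> U" "y \<in> V" by blast
      moreover from this have "U \<subseteq> V \<or> V \<subseteq> U" using ch by (auto simp: subset_chain_def)
      ultimately obtain W where "W \<in> \<C>" "x \<in> W" "y \<in> W" by blast
      then show ?thesis using c(1)[of W] by (auto simp: ideal_set_def)
    qed
    moreover have "t * x \<in> \<Union>\<C>" if "t \<in> T" "x \<in> \<Union>\<C>" for t x
      using that c(1) unfolding ideal_set_def by blast
    moreover obtain I where I: "I \<in> \<C>" using ne by blast
    moreover have "0 \<in> \<Union>\<C>" using I c(1)[OF I] by (auto simp: ideal_set_def)
    moreover have "\<Union>\<C> \<subseteq> T" using c(1) unfolding ideal_set_def by blast
    moreover have "J \<subseteq> \<Union>\<C>" using I c(2) by blast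
    moreover have "1 \<notin> \<Union>\<C>" using c(3) by blast
    ultimately show "\<Union>\<C> \<in> F"
      by (simp add: F_def ideal_set_def)
  qed
  then obtain Q where QF: "Q \<in> F" and maxF: "\<And>I. I \<in> F \<Longrightarrow> Q \<subseteq> I \<Longrightarrow> I = Q" by blast
  then have Q: "ideal_set T Q" "J \<subseteq> Q" "1 \<notin> Q" by (auto simp: F_def)
  have max: "I = Q" if "ideal_set T I" "Q \<subseteq> I" "1 \<notin> I" for I
    using maxF[of I] that Q(2) by (auto simp: F_def)
  have escape: "\<exists>q\<in>Q. \<exists>t\<in>T. 1 = q + t * x" if x: "x \<in> T" "x \<notin> Q" for x
  proof (rule ccontr)
    assume neg: "\<not> ?thesis"
    define I where "I = {q + t * x | q t. q \<in> Q \<and> t \<in> T}"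
    have "ideal_set T I"
      unfolding ideal_set_def
    proof (intro conjI ballI)
      show "I \<subseteq> T"
        using T Q(1) x by (auto simp: I_def ideal_set_def subring_set_def)
      show "0 \<in> I"
        unfolding I_def mem_Collect_eq
        by (rule exI[of _ 0], rule exI[of _ 0])
          (use Q(1) subring_set_zero[OF T] in \<open>simp add: ideal_set_def\<close>)
    next
      fix y z assume "y \<in> I" "z \<in> I"
      then obtain q t q' t' where "y = q + t * x" "z = q' + t' * x" "q \<in> Q" "q' \<in> Q" "t \<in> T" "t' \<in> T"
        by (auto simp: I_def)
      then have "y + z = (q + q') + (t + t') * x" "q + q' \<in> Q" "t + t' \<in> T"
        using Q(1) T by (auto simp: ideal_set_def subring_set_def algebra_simps)
      then show "y + z \<in> I" by (auto simp: I_def)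
    next
      fix s y assume "s \<in> T" "y \<in> I"
      then obtain q t where "y = q + t * x" "q \<in> Q" "t \<in> T"
        by (auto simp: I_def)
      then have "s * y = s * q + (s * t) * x" "s * q \<in> Q" "s * t \<in> T"
        using Q(1) T \<open>s \<in> T\<close> by (auto simp: ideal_set_def subring_set_def algebra_simps)
      then show "s * y \<in> I" by (auto simp: I_def)
    qed
    moreover have "q \<in> I" if "q \<in> Q" for q
      unfolding I_def mem_Collect_eq
      by (rule exI[of _ q], rule exI[of _ 0]) (use that subring_set_zero[OF T] in simp)
    moreover have "x \<in> I"
      unfolding I_def mem_Collect_eq
      by (rule exI[of _ 0], rule exI[of _ 1])
        (use Q(1) T in \<open>simp add: ideal_set_def subring_set_def\<close>)
    moreover have "1 \<notin> I" using neg by (auto simp: I_def)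
    ultimately show False using max[of I] x by blast
  qed
  have "x \<in> Q \<or> y \<in> Q" if xy: "x \<in> T" "y \<in> T" "x * y \<in> Q" for x y
  proof (rule ccontr)
    assume neg: "\<not> ?thesis"
    then obtain q t where qt: "q \<in> Q" "t \<in> T" "1 = q + t * x"
      using escape[of x] xy by blast
    have "y = 1 * y" by simp
    also have "\<dots> = y * q + t * (x * y)"
      by (subst qt(3)) (simp add: algebra_simps)
    also have "\<dots> \<in> Q"
      using Q(1) qt xy by (auto simp: ideal_set_def)
    finally show False using neg by blast
  qed
  with Q that show thesis by (auto simp: prime_ideal_set_def)
qed


section \<open>The homogeneous part of a prime ideal\<close>

locale group_grading = independent_family C
  for C :: "'d::ab_group_add \<Rightarrow> 'k::comm_ring_1 set" +
  assumes mult_mem: "x \<in> C d \<Longrightarrow> y \<in> C e \<Longrightarrow> x * y \<in> C (d + e)"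
    and one_mem: "1 \<in> C 0"
begin

definition homogeneous_part :: "'k set \<Rightarrow> 'k set \<Rightarrow> 'k set" where
  "homogeneous_part T Q = {x \<in> T. \<forall>f. decomposes C f x \<longrightarrow> (\<forall>d. f d \<in> Q)}"

text \<open>The components of a product are the convolution of the components of its factors.\<close>
lemma decomposes_mult:
  assumes "decomposes C f x" "decomposes C g y"
  defines "S \<equiv> {i. f i \<noteq> 0} \<times> {j. g j \<noteq> 0}"
  shows "decomposes C (\<lambda>d. \<Sum>p\<in>S. if d = fst p + snd p then f (fst p) * g (snd p) else 0) (x * y)"
proof -
  have "x * y = (\<Sum>i | f i \<noteq> 0. f i) * (\<Sum>j | g j \<noteq> 0. g j)"
    using decomposesD(3)[OF assms(1)] decomposesD(3)[OF assms(2)] by simp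
  also have "\<dots> = (\<Sum>p\<in>S. f (fst p) * g (snd p))"
    by (simp add: S_def sum_product sum.cartesian_product case_prod_unfold)
  finally show ?thesis
    using assms
    by (auto intro!: decomposes_sum decomposes_single mult_mem dest: decomposesD(1))
qed

text \<open>Order the degrees totally. Let \<open>m\<close> and \<open>n\<close> be the largest degrees in which \<open>x\<close> and \<open>y\<close> have a
  component outside \<open>Q\<close>. In the component of \<open>x y\<close> of degree \<open>m + n\<close>, every summand except the product of
  these two components has a factor in \<open>Q\<close>; hence that product is in \<open>Q\<close>, although neither factor is.\<close>
lemma homogeneous_part_prime:
  assumes tf: "\<And>n (x::'d). n > 0 \<Longrightarrow> multiple n x = 0 \<Longrightarrow> x = 0"
    and T: "subring_set T" and Tdec: "\<And>x. x \<in> T \<Longrightarrow> \<exists>f. decomposes C f x \<and> (\<forall>d. f d \<in> T)"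
    and Q: "prime_ideal_set T Q"
    and xy: "x \<in> T" "y \<in> T" "x * y \<in> homogeneous_part T Q"
  shows "x \<in> homogeneous_part T Q \<or> y \<in> homogeneous_part T Q"
proof (rule ccontr)
  assume neg: "\<not> ?thesis"
  have Qi: "ideal_set T Q" and Qp: "\<And>x y. x \<in> T \<Longrightarrow> y \<in> T \<Longrightarrow> x * y \<in> Q \<Longrightarrow> x \<in> Q \<or> y \<in> Q"
    using Q by (auto simp: prime_ideal_set_def)
  obtain f where f: "decomposes C f x" "\<And>d. f d \<in> T" using Tdec xy by blast
  obtain g where g: "decomposes C g y" "\<And>d. g d \<in> T" using Tdec xy by blast
  define A where "A = {d. f d \<notin> Q}"
  define B where "B = {d. g d \<notin> Q}"
  have "A \<noteq> {}" "B \<noteq> {}"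
    using neg xy decomposes_unique f(1) g(1) by (auto simp: homogeneous_part_def A_def B_def)
  have Q0: "0 \<in> Q" using Qi by (simp add: ideal_set_def)
  have AB: "A \<subseteq> {i. f i \<noteq> 0}" "B \<subseteq> {j. g j \<noteq> 0}" using Q0 by (auto simp: A_def B_def)
  then have "finite A" "finite B" using decomposesD(2) f(1) g(1) finite_subset by metis+
  obtain P :: "'d set" where P: "cone P" "\<And>x. x \<in> P \<or> - x \<in> P"
    using torsion_free_total_cone tf by blast
  obtain m where m: "m \<in> A" "\<And>a. a \<in> A \<Longrightarrow> m - a \<in> P"
    using total_cone_maximum[OF \<open>finite A\<close> \<open>A \<noteq> {}\<close> P] by blast
  obtain n where n: "n \<in> B" "\<And>b. b \<in> B \<Longrightarrow> n - b \<in> P"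
    using total_cone_maximum[OF \<open>finite B\<close> \<open>B \<noteq> {}\<close> P] by blast
  define S where "S = {i. f i \<noteq> 0} \<times> {j. g j \<noteq> 0}"
  have S: "finite S" "(m, n) \<in> S"
    using decomposesD(2)[OF f(1)] decomposesD(2)[OF g(1)] AB m(1) n(1) by (auto simp: S_def)
  define t where "t p = (if m + n = fst p + snd p then f (fst p) * g (snd p) else 0)" for p
  have "sum t S \<in> Q"
    using decomposes_mult[OF f(1) g(1)] xy(3)
    unfolding homogeneous_part_def S_def[symmetric] t_def by blast
  moreover have "t p \<in> Q" if "p \<in> S - {(m, n)}" for p
  proof -
    obtain i j where p: "p = (i, j)" by force
    \<comment> \<open>In the last case \<open>m - i\<close> and \<open>n - j\<close> are nonnegative with sum zero, so both vanish.\<close>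
    consider "m + n \<noteq> i + j" | "i \<notin> A" | "j \<notin> B" | "m + n = i + j" "i \<in> A" "j \<in> B" by blast
    then show ?thesis
    proof cases
      case 1
      then show ?thesis using Q0 by (simp add: t_def p)
    next
      case 2
      then have "g j * f i \<in> Q" using Qi g(2) by (auto simp: A_def ideal_set_def)
      then show ?thesis using Q0 by (simp add: t_def p mult.commute)
    next
      case 3
      then have "f i * g j \<in> Q" using Qi f(2) by (auto simp: B_def ideal_set_def)
      then show ?thesis using Q0 by (simp add: t_def p)
    next
      case 4
      have "- (m - i) = n - j" using 4(1) by (simp add: algebra_simps)
      then have "m - i = 0" using m(2)[OF 4(2)] n(2)[OF 4(3)] P(1) unfolding cone_def by metis
      then have "p = (m, n)" using 4(1) p by simp
      then show ?thesis using that by blast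
    qed
  qed
  ultimately have "sum t S + - sum t (S - {(m, n)}) \<in> Q"
    using Qi ideal_set_uminus[OF T Qi] ideal_set_sum[OF Qi, of "S - {(m, n)}" t]
    unfolding ideal_set_def by blast
  then have "t (m, n) \<in> Q" using sum.remove[OF S, of t] by simp
  then have "f m * g n \<in> Q" by (simp add: t_def)
  then show False using Qp[OF f(2) g(2)] m(1) n(1) by (auto simp: A_def B_def)
qed

lemma mem_homogeneous_part:
  assumes "ideal_set T Q" "x \<in> Q" "x \<in> C d"
  shows "x \<in> homogeneous_part T Q"
proof -
  have "f e \<in> Q" if "decomposes C f x" for f e
    using decomposes_unique[OF that decomposes_single[OF assms(3)]] assms
    by (simp add: ideal_set_def)
  then show ?thesis using assms by (auto simp: homogeneous_part_def ideal_set_def)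
qed

text \<open>Besides being prime, the homogeneous part is generated by the homogeneous elements of \<open>Q\<close>, since its
  elements are the sums of their components.\<close>
lemma homogeneous_part_homogeneous_prime:
  assumes tf: "\<And>n (x::'d). n > 0 \<Longrightarrow> multiple n x = 0 \<Longrightarrow> x = 0"
    and T: "subring_set T" and Tdec: "\<And>x. x \<in> T \<Longrightarrow> \<exists>f. decomposes C f x \<and> (\<forall>d. f d \<in> T)"
    and Q: "prime_ideal_set T Q"
  shows "homogeneous_prime_ideal T (\<lambda>d. T \<inter> C d) (homogeneous_part T Q)"
proof -
  let ?H = "homogeneous_part T Q"
  interpret rg: cring "ring_on T" by (rule cring_ring_on) fact
  have Qi: "ideal_set T Q" using Q by (simp add: prime_ideal_set_def)
  have HI: "x \<in> ?H" if "decomposes C f x" "\<And>d. f d \<in> Q" "x \<in> T" for f x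
    using that decomposes_unique unfolding homogeneous_part_def by blast
  have HE: "\<exists>f. decomposes C f x \<and> (\<forall>d. f d \<in> Q)" if "x \<in> ?H" for x
    using that Tdec unfolding homogeneous_part_def by blast
  have HQ: "x \<in> Q" if "x \<in> ?H" for x
    using HE[OF that] ideal_set_sum[OF Qi] decomposesD(3) by metis
  have QH: "x \<in> ?H" if "x \<in> Q" "x \<in> C d" for x d
    by (rule mem_homogeneous_part[OF Qi that])
  have Hadd: "x + y \<in> ?H" if xy: "x \<in> ?H" "y \<in> ?H" for x y
  proof -
    obtain f g where "decomposes C f x" "\<And>d. f d \<in> Q" "decomposes C g y" "\<And>d. g d \<in> Q"
      using HE xy by metis
    moreover have "x + y \<in> T" using xy T by (auto simp: homogeneous_part_def subring_set_def)
    ultimately show ?thesis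
      using Qi by (intro HI[OF decomposes_add]) (auto simp: ideal_set_def)
  qed
  have Hmult: "s * x \<in> ?H" if sx: "s \<in> T" "x \<in> ?H" for s x
  proof -
    obtain g where g: "decomposes C g x" "\<And>d. g d \<in> Q" using HE sx by metis
    obtain f where f: "decomposes C f s" "\<And>d. f d \<in> T" using Tdec sx by blast
    have "s * x \<in> T" using sx T by (auto simp: homogeneous_part_def subring_set_def)
    then show ?thesis
      using Qi f(2) g(2)
      by (intro HI[OF decomposes_mult[OF f(1) g(1)]] ideal_set_sum[OF Qi])
        (auto simp: ideal_set_def)
  qed
  have Hi: "ideal_set T ?H"
    unfolding ideal_set_def
  proof (intro conjI ballI)
    show "?H \<subseteq> T" by (auto simp: homogeneous_part_def)
    show "0 \<in> ?H" using HI[OF decomposes_zero] Qi subring_set_zero[OF T] by (simp add: ideal_set_def)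
  qed (fact Hadd, fact Hmult)
  have "1 \<notin> ?H" using HQ Q unfolding prime_ideal_set_def by blast
  moreover have "x \<in> ?H \<or> y \<in> ?H" if "x \<in> T" "y \<in> T" "x * y \<in> ?H" for x y
    by (rule homogeneous_part_prime[OF _ T _ Q that]) (fact tf, fact Tdec)
  ultimately have "prime_ideal_set T ?H"
    using Hi by (simp add: prime_ideal_set_def)
  moreover have "homogeneous_ideal T (\<lambda>d. T \<inter> C d) ?H"
    unfolding homogeneous_ideal_def
  proof (intro exI conjI)
    let ?G = "?H \<inter> homogeneous_elements (\<lambda>d. T \<inter> C d)"
    show "?G \<subseteq> homogeneous_elements (\<lambda>d. T \<inter> C d)" by blast
    have "ideal (genideal (ring_on T) ?G) (ring_on T)"
      by (rule rg.genideal_ideal) (auto simp: homogeneous_part_def)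
    then have gi: "ideal_set T (genideal (ring_on T) ?G)"
      using ideal_ring_on_iff[OF T] by blast
    have gs: "?G \<subseteq> genideal (ring_on T) ?G"
      by (rule rg.genideal_self) (auto simp: homogeneous_part_def)
    show "?H = genideal (ring_on T) ?G"
    proof
      show "genideal (ring_on T) ?G \<subseteq> ?H"
        by (rule rg.genideal_minimal) (use Hi ideal_ring_on_iff[OF T] in auto)
      show "?H \<subseteq> genideal (ring_on T) ?G"
      proof
        fix x assume "x \<in> ?H"
        then obtain f where f: "decomposes C f x" "\<And>d. f d \<in> Q" using HE by blast
        have "f d \<in> genideal (ring_on T) ?G" if "f d \<noteq> 0" for d
        proof -
          have fd: "f d \<in> C d" using f(1) by (rule decomposesD)
          have fH: "f d \<in> ?H" using QH[OF f(2) fd] .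
          then have "f d \<in> T" by (simp add: homogeneous_part_def)
          with fd fH that have "f d \<in> ?G" unfolding homogeneous_elements_def by blast
          then show ?thesis using gs by blast
        qed
        then show "x \<in> genideal (ring_on T) ?G"
          using ideal_set_sum[OF gi, of "{d. f d \<noteq> 0}" f] decomposesD(3)[OF f(1)] by simp
      qed
    qed
  qed
  ultimately show ?thesis
    by (simp add: primeideal_ring_on_iff[OF T] homogeneous_prime_ideal_def)
qed

end


section \<open>Relations of unity in two opposite directions\<close>

text \<open>The intended example is \<open>D i = K\<^sub>0 \<inter> M w\<^sup>i\<close>, where \<open>K\<^sub>0\<close> is the degree-\<open>0\<close> part of a graded field of
  fractions and \<open>M\<close> the set of homogeneous elements of the maximal homogeneous ideal of a localization.
  The assumption \<open>divide\<close> then says that \<open>1 - x\<close> is a unit of the localization for \<open>x\<close> in that ideal.\<close>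
locale relation_family =
  fixes D :: "int \<Rightarrow> 'k::field set"
  assumes zero: "0 \<in> D i"
    and add: "x \<in> D i \<Longrightarrow> y \<in> D i \<Longrightarrow> x + y \<in> D i"
    and mult: "x \<in> D i \<Longrightarrow> y \<in> D j \<Longrightarrow> x * y \<in> D (i + j)"
    and one_notin: "1 \<notin> D 0"
    and divide: "x \<in> D 0 \<Longrightarrow> y \<in> D j \<Longrightarrow> y / (1 - x) \<in> D j"
begin

text \<open>Write the two relations as \<open>1 = y + z\<close> with top term \<open>z \<in> D n\<close>, and \<open>1 = u + v\<close> with \<open>v \<in> D 0\<close> and \<open>u\<close>
  a sum of terms of indices \<open>- 1, \<dots>, - m\<close>. Then \<open>z = (z / (1 - v)) u\<close>, whose terms have indices between
  \<open>n - m\<close> and \<open>n - 1\<close>; the hypothesis \<open>m \<le> n\<close> keeps them nonnegative.\<close>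
lemma relation_descent:
  assumes pos: "1 \<in> add_span (\<Union>i\<le>n. D (int i))" and neg: "1 \<in> add_span (\<Union>j\<le>m. D (- int j))"
    and "m \<le> n" "0 < n"
  shows "1 \<in> add_span (\<Union>i\<le>n - 1. D (int i))"
proof -
  have "{..n} = insert n {..n - 1}" using \<open>0 < n\<close> by auto
  then have "(\<Union>i\<le>n. D (int i)) = (\<Union>i\<le>n - 1. D (int i)) \<union> D (int n)" by auto
  then obtain y z where yz: "y \<in> add_span (\<Union>i\<le>n - 1. D (int i))" "z \<in> D (int n)" "1 = y + z"
    using add_span_Un_closed[of 1 "\<Union>i\<le>n - 1. D (int i)" "D (int n)"] pos zero add by metis
  have "{..m} = insert 0 {1..m}" by auto
  then have "(\<Union>j\<le>m. D (- int j)) = (\<Union>j\<in>{1..m}. D (- int j)) \<union> D 0" by auto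
  then obtain u v where uv: "u \<in> add_span (\<Union>j\<in>{1..m}. D (- int j))" "v \<in> D 0" "1 = u + v"
    using add_span_Un_closed[of 1 "\<Union>j\<in>{1..m}. D (- int j)" "D 0"] neg zero add by metis
  define c where "c = z / (1 - v)"
  have c: "c \<in> D (int n)" using divide uv yz by (simp add: c_def)
  have "1 - v \<noteq> 0" using uv(2) one_notin by auto
  moreover have "u = 1 - v" using uv(3) by (simp add: algebra_simps)
  ultimately have "z = c * u" by (simp add: c_def)
  also have "c * u \<in> add_span (\<Union>i\<le>n - 1. D (int i))"
    using uv(1)
  proof (rule add_span_mult_left)
    fix g assume "g \<in> (\<Union>j\<in>{1..m}. D (- int j))"
    then obtain j where j: "1 \<le> j" "j \<le> m" "g \<in> D (- int j)" by auto
    then have "c * g \<in> D (int (n - j))" using mult[OF c j(3)] \<open>m \<le> n\<close> by (simp add: of_nat_diff)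
    moreover have "n - j \<le> n - 1" using j by simp
    ultimately show "c * g \<in> add_span (\<Union>i\<le>n - 1. D (int i))" by (intro add_span_base) blast
  qed
  finally show ?thesis using yz add_span_add by metis
qed

end

lemma relation_family_uminus:
  assumes "relation_family D"
  shows "relation_family (\<lambda>i. D (- i))"
proof -
  interpret relation_family D by fact
  show ?thesis
  proof
    fix x y i j assume "x \<in> D (- i)" "y \<in> D (- j)"
    from mult[OF this] show "x * y \<in> D (- (i + j))" by simp
  qed (simp_all add: zero add one_notin divide)
qed

text \<open>Shorten the longer of the two relations, until one of them reads \<open>1 \<in> D 0\<close>.\<close>
lemma no_opposite_relations_bounded:
  assumes "relation_family D"
  shows "1 \<in> add_span (\<Union>i\<le>n. D (int i)) \<Longrightarrow> 1 \<in> add_span (\<Union>j\<le>m. D (- int j)) \<Longrightarrow> False"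
proof (induction "n + m" arbitrary: n m rule: less_induct)
  case less
  interpret relation_family D by fact
  interpret op: relation_family "\<lambda>i. D (- i)" using assms by (rule relation_family_uminus)
  have triv: "1 \<notin> add_span (D 0)"
    using add_span_least[of 1 "D 0" "D 0"] zero add one_notin by blast
  have nm: "0 < n" "0 < m" using triv less.prems by (auto intro!: gr0I)
  show False
  proof (cases "m \<le> n")
    case True
    then show ?thesis
      using less.hyps[of "n - 1" m] relation_descent[OF less.prems] less.prems(2) nm by simp
  next
    case False
    then show ?thesis
      using less.hyps[of n "m - 1"] op.relation_descent[of m n] less.prems nm by simp
  qed
qed

lemma add_span_UN_bounded:
  fixes D :: "nat \<Rightarrow> 'a::comm_monoid_add set"
  assumes "x \<in> add_span (\<Union>i. D i)"
  shows "\<exists>n. x \<in> add_span (\<Union>i\<le>n. D i)"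
  using assms
proof (induction rule: add_span.induct)
  case zero
  show ?case by (auto intro: add_span.zero)
next
  case (step g x)
  then obtain n i where n: "x \<in> add_span (\<Union>i\<le>n. D i)" "g \<in> D i" by blast
  have "(\<Union>i\<le>n. D i) \<subseteq> (\<Union>j\<le>max n i. D j)" by force
  then have "x \<in> add_span (\<Union>j\<le>max n i. D j)" using n add_span_mono by blast
  moreover have "g \<in> (\<Union>j\<le>max n i. D j)" using n by auto
  ultimately show ?case by (blast intro: add_span.step)
qed

lemma no_opposite_relations:
  assumes "relation_family D"
    "1 \<in> add_span (\<Union>i. D (int i))" "1 \<in> add_span (\<Union>j. D (- int j))"
  shows False
  using no_opposite_relations_bounded[OF assms(1)] add_span_UN_bounded[OF assms(2)]
    add_span_UN_bounded[OF assms(3)] by blast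


section \<open>The grading of the homogeneous quotient field\<close>

lemma of_monoid_0 [simp]: "of_monoid 0 = 0"
  by transfer (simp add: same_diff_def)

lemma quotient_group_torsion_free:
  assumes "torsionless TYPE('g::cancel_comm_monoid_add)"
    and n: "n > 0" and x: "multiple n (x :: 'g quotient_group) = 0"
  shows "x = 0"
proof -
  obtain \<alpha> \<beta> :: 'g where ab: "x = of_monoid \<alpha> - of_monoid \<beta>"
    using quotient_group_eq_diff by blast
  have "multiple k x = of_monoid (\<Sum>i<k. \<alpha>) - of_monoid (\<Sum>i<k. \<beta>)" for k
    by (induction k) (auto simp: ab of_monoid_add algebra_simps)
  with x have "of_monoid (\<Sum>i<n. \<alpha>) = of_monoid (\<Sum>i<n. \<beta>)"
    by simp
  then have "(\<Sum>i<n. \<alpha>) = (\<Sum>i<n. \<beta>)" by (simp only: of_monoid_inject)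
  then have "\<alpha> = \<beta>" using assms(1) n unfolding torsionless_def by blast
  then show ?thesis by (simp add: ab)
qed

lemma to_fract_decomposes:
  assumes "decomposes R f x"
  shows "(\<Sum>i | f i \<noteq> 0. to_fract (f i)) = to_fract x"
  using decomposesD(3)[OF assms] to_fract_sum[of f "{i. f i \<noteq> 0}"] by metis

locale graded =
  fixes R :: "'g::cancel_comm_monoid_add \<Rightarrow> 'a::idom set"
  assumes graded_domain: "graded_domain R"
begin

lemma mult_mem: "x \<in> R \<alpha> \<Longrightarrow> y \<in> R \<beta> \<Longrightarrow> x * y \<in> R (\<alpha> + \<beta>)"
  using graded_domain by (simp add: graded_domain_def)

lemma decomposes_ex1: "\<exists>!f. decomposes R f x"
  using graded_domain unfolding graded_domain_def internal_direct_sum_def decomposes_def by blast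

sublocale independent_family R
proof -
  have sub: "additive_subgroup (R \<alpha>) (ring_on UNIV)" for \<alpha>
    using graded_domain unfolding graded_domain_def internal_direct_sum_def by blast
  note * = sub[unfolded additive_subgroup_ring_on_iff[OF subring_set_UNIV]]
  interpret additive_family R by standard (use * in auto)
  show "independent_family R"
  proof
    fix D f i assume D: "finite D" "\<And>i. i \<in> D \<Longrightarrow> f i \<in> R i" "sum f D = 0" "i \<in> D"
    have "decomposes R (\<lambda>i. if i \<in> D then f i else 0) 0"
      using D by (intro decomposesI[where D = D]) (auto simp: zero_mem)
    then have "(\<lambda>i. if i \<in> D then f i else 0) = (\<lambda>_. 0)"
      using decomposes_zero decomposes_ex1 by blast
    then show "f i = 0" using D(4) by metis
  qed
qed

abbreviation quot_comp :: "'g quotient_group \<Rightarrow> 'a fract set" where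
  "quot_comp \<equiv> quotient_field_component R"

lemma quot_compI:
  assumes "a \<in> R \<alpha>" "b \<in> R \<beta>" "b \<noteq> 0" "x = to_fract a / to_fract b"
    "d = of_monoid \<alpha> - of_monoid \<beta>"
  shows "x \<in> quot_comp d"
proof (cases "a = 0")
  case False
  then show ?thesis using assms
    unfolding quotient_field_component_def Fract_conv_to_fract by blast
qed (use assms in \<open>simp add: quotient_field_component_def\<close>)

lemma quot_compE:
  assumes "x \<in> quot_comp d" "x \<noteq> 0"
  obtains a b \<alpha> \<beta> where "a \<in> R \<alpha>" "b \<in> R \<beta>" "a \<noteq> 0" "b \<noteq> 0" "x = to_fract a / to_fract b"
    "d = of_monoid \<alpha> - of_monoid \<beta>"
  using assms unfolding quotient_field_component_def Fract_conv_to_fract by blast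

lemma zero_mem_quot_comp: "0 \<in> quot_comp d"
  by (simp add: quotient_field_component_def)

text \<open>Multiplying each fraction by the denominators of the others keeps every numerator homogeneous. The
  numerators then have distinct degrees, because the degree of the common denominator is subtracted from all
  of them. For empty \<open>D\<close> the statement provides a nonzero homogeneous element.\<close>
lemma quot_comp_common_denominator:
  assumes "finite D" "\<And>d. d \<in> D \<Longrightarrow> f d \<in> quot_comp d \<and> f d \<noteq> 0"
  shows "\<exists>b \<beta> a \<alpha>. b \<in> R \<beta> \<and> b \<noteq> 0 \<and>
    (\<forall>d\<in>D. a d \<in> R (\<alpha> d) \<and> f d = to_fract (a d) / to_fract b \<and> d = of_monoid (\<alpha> d) - of_monoid \<beta>)"
  using assms
proof (induction D rule: finite_induct)
  case empty
  obtain g where g: "decomposes R g (1::'a)" using decomposes_ex1 by blast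
  have "\<exists>i. g i \<noteq> 0"
  proof (rule ccontr)
    assume "\<not> ?thesis"
    then show False using decomposesD(3)[OF g] by simp
  qed
  then show ?case using decomposesD(1)[OF g] by blast
next
  case (insert d D)
  have "f e \<in> quot_comp e \<and> f e \<noteq> 0" if "e \<in> D" for e
    using insert.prems that by blast
  from insert.IH[OF this] obtain b \<beta> a \<alpha> where IH: "b \<in> R \<beta>" "b \<noteq> 0"
    "\<And>e. e \<in> D \<Longrightarrow> a e \<in> R (\<alpha> e) \<and> f e = to_fract (a e) / to_fract b \<and> e = of_monoid (\<alpha> e) - of_monoid \<beta>"
    by blast
  obtain a' b' \<alpha>' \<beta>' where new: "a' \<in> R \<alpha>'" "b' \<in> R \<beta>'" "b' \<noteq> 0" "f d = to_fract a' / to_fract b'"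
    "d = of_monoid \<alpha>' - of_monoid \<beta>'"
    using insert.prems[of d] by (auto elim!: quot_compE)
  define a2 where "a2 e = (if e = d then a' * b else a e * b')" for e
  define \<alpha>2 where "\<alpha>2 e = (if e = d then \<alpha>' + \<beta> else \<alpha> e + \<beta>')" for e
  have "a2 e \<in> R (\<alpha>2 e) \<and> f e = to_fract (a2 e) / to_fract (b * b') \<and>
      e = of_monoid (\<alpha>2 e) - of_monoid (\<beta> + \<beta>')" if e: "e \<in> insert d D" for e
  proof (cases "e = d")
    case True
    have "d = of_monoid (\<alpha>' + \<beta>) - of_monoid (\<beta> + \<beta>')"
      unfolding new(5) by (simp add: of_monoid_add)
    then show ?thesis using True new(1-4) IH(1,2) by (simp add: a2_def \<alpha>2_def mult_mem)
  next
    case False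
    then have e: "e \<in> D" using e by simp
    have "e = of_monoid (\<alpha> e + \<beta>') - of_monoid (\<beta> + \<beta>')"
      using IH(3)[OF e] by (simp add: of_monoid_add)
    then show ?thesis using False IH(3)[OF e] new(2,3) by (simp add: a2_def \<alpha>2_def mult_mem)
  qed
  moreover have "b * b' \<in> R (\<beta> + \<beta>')" "b * b' \<noteq> 0" using IH new by (auto intro: mult_mem)
  ultimately show ?case by blast
qed

text \<open>Independence is inherited from \<open>R\<close>: over a common denominator, a vanishing sum of fractions of distinct
  degrees becomes a vanishing sum of homogeneous elements of distinct degrees.\<close>
sublocale QF: group_grading "quotient_field_component R"
proof
  show "0 \<in> quot_comp d" for d by (rule zero_mem_quot_comp)
next
  fix x y d assume xy: "x \<in> quot_comp d" "y \<in> quot_comp d"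
  show "x + y \<in> quot_comp d"
  proof (cases "x = 0 \<or> y = 0")
    case False
    from xy(1) False obtain a b \<alpha> \<beta> where x: "a \<in> R \<alpha>" "b \<in> R \<beta>" "b \<noteq> 0"
      "x = to_fract a / to_fract b" "d = of_monoid \<alpha> - of_monoid \<beta>" by (auto elim: quot_compE)
    from xy(2) False obtain a' b' \<alpha>' \<beta>' where y: "a' \<in> R \<alpha>'" "b' \<in> R \<beta>'" "b' \<noteq> 0"
      "y = to_fract a' / to_fract b'" "d = of_monoid \<alpha>' - of_monoid \<beta>'" by (auto elim: quot_compE)
    have eq: "\<alpha> + \<beta>' = \<alpha>' + \<beta>" using x(5) y(5) of_monoid_diff_eq_iff by metis
    have "a * b' + a' * b \<in> R (\<alpha> + \<beta>')"
      using mult_mem[OF x(1) y(2)] mult_mem[OF y(1) x(2)] eq by (auto intro: add_mem)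
    moreover have "b * b' \<in> R (\<beta> + \<beta>')" using x y by (auto intro: mult_mem)
    moreover have "x + y = to_fract (a * b' + a' * b) / to_fract (b * b')"
      using x(3,4) y(3,4) by (simp add: field_simps)
    moreover have "d = of_monoid (\<alpha> + \<beta>') - of_monoid (\<beta> + \<beta>')"
      using x(5) by (simp add: of_monoid_add)
    ultimately show ?thesis using x(3) y(3) by (intro quot_compI[of "a * b' + a' * b" _ "b * b'"]) auto
  qed (use xy in auto)
next
  fix x d assume x: "x \<in> quot_comp d"
  show "- x \<in> quot_comp d"
  proof (cases "x = 0")
    case False
    with x obtain a b \<alpha> \<beta> where "a \<in> R \<alpha>" "b \<in> R \<beta>" "b \<noteq> 0"
      "x = to_fract a / to_fract b" "d = of_monoid \<alpha> - of_monoid \<beta>" by (auto elim: quot_compE)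
    then show ?thesis by (intro quot_compI[of "- a" _ b]) (auto intro: uminus_mem)
  qed (use x in simp)
next
  fix D and f :: "'g quotient_group \<Rightarrow> 'a fract" and i
  assume D: "finite D" "\<And>i. i \<in> D \<Longrightarrow> f i \<in> quot_comp i" "sum f D = 0" "i \<in> D"
  show "f i = 0"
  proof (rule ccontr)
    assume fi: "f i \<noteq> 0"
    define E where "E = {d \<in> D. f d \<noteq> 0}"
    have "finite E" using D(1) by (simp add: E_def)
    moreover have "f d \<in> quot_comp d \<and> f d \<noteq> 0" if "d \<in> E" for d using D(2) that by (simp add: E_def)
    ultimately have "\<exists>b \<beta> a \<alpha>. b \<in> R \<beta> \<and> b \<noteq> 0 \<and> (\<forall>d\<in>E. a d \<in> R (\<alpha> d) \<and>
        f d = to_fract (a d) / to_fract b \<and> d = of_monoid (\<alpha> d) - of_monoid \<beta>)"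
      by (rule quot_comp_common_denominator)
    then obtain b \<beta> a \<alpha> where
      b: "b \<in> R \<beta>" "b \<noteq> 0" and
      a: "\<forall>d\<in>E. a d \<in> R (\<alpha> d) \<and> f d = to_fract (a d) / to_fract b \<and> d = of_monoid (\<alpha> d) - of_monoid \<beta>"
      by blast
    have "sum f D = sum f E"
      by (rule sum.mono_neutral_right[OF D(1)]) (auto simp: E_def)
    then have "0 = sum f E" using D(3) by simp
    also have "\<dots> = (\<Sum>d\<in>E. to_fract (a d) / to_fract b)"
      using a by (intro sum.cong refl) blast
    also have "\<dots> = (\<Sum>d\<in>E. to_fract (a d)) / to_fract b"
      by (rule sum_divide_distrib[symmetric])
    also have "\<dots> = to_fract (sum a E) / to_fract b"
      by (simp only: to_fract_sum)
    finally have "to_fract (sum a E) = 0" using b(2) by (metis divide_eq_0_iff to_fract_eq_0_iff)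
    then have "(\<Sum>d\<in>E. a d) = 0" by (simp only: to_fract_eq_0_iff)
    have aR: "a d \<in> R (\<alpha> d)" if "d \<in> E" for d using a that by blast
    have \<alpha>_inj: "d = e" if "d \<in> E" "e \<in> E" "\<alpha> d = \<alpha> e" for d e
      using a that by metis
    have iE: "i \<in> E" using D(4) fi by (simp add: E_def)
    \<comment> \<open>The component of degree \<open>\<gamma>\<close> of the sum of the numerators.\<close>
    define h where "h \<gamma> = (\<Sum>d\<in>E. if \<gamma> = \<alpha> d then a d else 0)" for \<gamma>
    have "decomposes R h (\<Sum>d\<in>E. a d)"
      unfolding h_def by (intro decomposes_sum decomposes_single aR)
    then have "h = (\<lambda>_. 0)"
      unfolding \<open>(\<Sum>d\<in>E. a d) = 0\<close> using decomposes_zero by (rule decomposes_unique)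
    then have "0 = h (\<alpha> i)" by simp
    also have "\<dots> = (\<Sum>d\<in>E. if d = i then a d else 0)"
      unfolding h_def using \<alpha>_inj[OF iE] by (intro sum.cong refl) metis
    also have "\<dots> = a i" using \<open>finite E\<close> iE by simp
    finally have "f i = 0" using a iE by force
    then show False using fi by contradiction
  qed
next
  fix x y d e assume xy: "x \<in> quot_comp d" "y \<in> quot_comp e"
  show "x * y \<in> quot_comp (d + e)"
  proof (cases "x = 0 \<or> y = 0")
    case False
    from xy(1) False obtain a b \<alpha> \<beta> where x: "a \<in> R \<alpha>" "b \<in> R \<beta>" "b \<noteq> 0"
      "x = to_fract a / to_fract b" "d = of_monoid \<alpha> - of_monoid \<beta>" by (auto elim: quot_compE)
    from xy(2) False obtain a' b' \<alpha>' \<beta>' where y: "a' \<in> R \<alpha>'" "b' \<in> R \<beta>'" "b' \<noteq> 0"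
      "y = to_fract a' / to_fract b'" "e = of_monoid \<alpha>' - of_monoid \<beta>'" by (auto elim: quot_compE)
    show ?thesis
      by (rule quot_compI[OF mult_mem[OF x(1) y(1)] mult_mem[OF x(2) y(2)]])
        (use x y in \<open>simp_all add: of_monoid_add\<close>)
  qed (auto simp: zero_mem_quot_comp)
next
  obtain b \<beta> where "b \<in> R \<beta>" "b \<noteq> 0" using quot_comp_common_denominator[of "{}"] by blast
  then show "1 \<in> quot_comp 0" by (intro quot_compI[of b \<beta> b \<beta>]) auto
qed

lemma inverse_mem_quot_comp:
  assumes "x \<in> quot_comp d"
  shows "inverse x \<in> quot_comp (- d)"
proof (cases "x = 0")
  case False
  with assms obtain a b \<alpha> \<beta> where "a \<in> R \<alpha>" "b \<in> R \<beta>" "a \<noteq> 0" "b \<noteq> 0"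
    "x = to_fract a / to_fract b" "d = of_monoid \<alpha> - of_monoid \<beta>" by (auto elim: quot_compE)
  then show ?thesis by (intro quot_compI[of b _ a]) auto
qed (simp add: zero_mem_quot_comp)

lemma power_mem_quot_comp: "w \<in> quot_comp \<omega> \<Longrightarrow> \<exists>e. w ^ n \<in> quot_comp e"
proof (induction n)
  case 0
  show ?case using QF.one_mem by auto
next
  case (Suc n)
  then show ?case using QF.mult_mem by fastforce
qed

lemma power_int_mem_quot_comp:
  assumes "w \<in> quot_comp \<omega>"
  shows "\<exists>e. w powi i \<in> quot_comp e"
  using power_mem_quot_comp[OF assms] power_mem_quot_comp[OF inverse_mem_quot_comp[OF assms]]
  by (auto simp: power_int_def)

end


section \<open>Adjoining a homogeneous fraction to the localization at a homogeneous prime\<close>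

locale graded_prime = graded R for R :: "'g::cancel_comm_monoid_add \<Rightarrow> 'a::idom set" +
  fixes P :: "'a set"
  assumes homogeneous_prime: "homogeneous_prime_ideal UNIV R P"
begin

lemma prime_P: "prime_ideal_set UNIV P"
  using homogeneous_prime primeideal_ring_on_iff[OF subring_set_UNIV]
  by (auto simp: homogeneous_prime_ideal_def)

lemma ideal_P: "ideal_set UNIV P"
  using prime_P by (simp add: prime_ideal_set_def)

lemma zero_P: "0 \<in> P"
  using ideal_P by (simp add: ideal_set_def)

lemma mult_notin_P: "x \<notin> P \<Longrightarrow> y \<notin> P \<Longrightarrow> x * y \<notin> P"
  using prime_P by (auto simp: prime_ideal_set_def)

lemma homogeneous_notin_P: obtains s \<sigma> where "s \<in> R \<sigma>" "s \<notin> P"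
proof (rule ccontr)
  assume neg: "\<not> thesis"
  obtain g where g: "decomposes R g (1::'a)" using decomposes_ex1 by blast
  have "g i \<in> P" for i using neg that decomposesD(1)[OF g] by blast
  then have "1 \<in> P" using ideal_set_sum[OF ideal_P, of _ g] decomposesD(3)[OF g] by metis
  then show False using prime_P by (simp add: prime_ideal_set_def)
qed

text \<open>With \<open>U = UNIV\<close> these are the homogeneous elements of degree \<open>d\<close> of the localization of \<open>R\<close> at the
  homogeneous elements outside \<open>P\<close>; with \<open>U = P\<close>, those of its maximal homogeneous ideal. Treating both
  at once, for an ideal \<open>U\<close>, lets the closure properties be proved once.\<close>
definition fractions :: "'a set \<Rightarrow> 'g quotient_group \<Rightarrow> 'a fract set" where
  "fractions U d = {to_fract r / to_fract s | r s \<alpha> \<beta>.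
     r \<in> R \<alpha> \<and> r \<in> U \<and> s \<in> R \<beta> \<and> s \<notin> P \<and> d = of_monoid \<alpha> - of_monoid \<beta>}"

lemma fractionsE:
  assumes "x \<in> fractions U d"
  obtains r s \<alpha> \<beta> where "x = to_fract r / to_fract s" "r \<in> R \<alpha>" "r \<in> U" "s \<in> R \<beta>" "s \<notin> P" "s \<noteq> 0"
    "d = of_monoid \<alpha> - of_monoid \<beta>"
  using assms zero_P unfolding fractions_def by blast

lemma fractionsI:
  assumes "r \<in> R \<alpha>" "r \<in> U" "s \<in> R \<beta>" "s \<notin> P" "x = to_fract r / to_fract s"
    "d = of_monoid \<alpha> - of_monoid \<beta>"
  shows "x \<in> fractions U d"
  using assms unfolding fractions_def by blast

lemma fractions_quot_comp: "x \<in> fractions U d \<Longrightarrow> x \<in> quot_comp d"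
  by (erule fractionsE, rule quot_compI)

lemma fractions_uminus:
  assumes "ideal_set UNIV U" "x \<in> fractions U d"
  shows "- x \<in> fractions U d"
  using assms(2)
proof (rule fractionsE)
  fix r s \<alpha> \<beta>
  assume "x = to_fract r / to_fract s" "r \<in> R \<alpha>" "r \<in> U" "s \<in> R \<beta>" "s \<notin> P"
    "d = of_monoid \<alpha> - of_monoid \<beta>"
  then show ?thesis
    using ideal_set_uminus[OF subring_set_UNIV assms(1)]
    by (intro fractionsI[of "- r" \<alpha> U s \<beta>]) (auto intro: uminus_mem)
qed

lemma fractions_add:
  assumes U: "ideal_set UNIV U" and x: "x \<in> fractions U d" and y: "y \<in> fractions U d"
  shows "x + y \<in> fractions U d"
proof -
  from x obtain r s \<alpha> \<beta> where x: "x = to_fract r / to_fract s" "r \<in> R \<alpha>" "r \<in> U"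
    "s \<in> R \<beta>" "s \<notin> P" "s \<noteq> 0" "d = of_monoid \<alpha> - of_monoid \<beta>" by (rule fractionsE)
  from y obtain r' s' \<alpha>' \<beta>' where y: "y = to_fract r' / to_fract s'" "r' \<in> R \<alpha>'" "r' \<in> U"
    "s' \<in> R \<beta>'" "s' \<notin> P" "s' \<noteq> 0" "d = of_monoid \<alpha>' - of_monoid \<beta>'" by (rule fractionsE)
  have eq: "\<alpha> + \<beta>' = \<alpha>' + \<beta>" using x(7) y(7) of_monoid_diff_eq_iff by metis
  show ?thesis
  proof (rule fractionsI)
    show "s' * r + s * r' \<in> R (\<alpha> + \<beta>')"
      using mult_mem[OF x(2) y(4)] mult_mem[OF y(2) x(4)] eq
      by (auto intro: add_mem simp: mult.commute)
    show "s' * r + s * r' \<in> U" using U x(3) y(3) by (auto simp: ideal_set_def)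
    show "s * s' \<in> R (\<beta> + \<beta>')" using x y by (auto intro: mult_mem)
    show "s * s' \<notin> P" using x y by (simp add: mult_notin_P)
    show "x + y = to_fract (s' * r + s * r') / to_fract (s * s')"
      using x(1,6) y(1,6) by (simp add: field_simps)
    show "d = of_monoid (\<alpha> + \<beta>') - of_monoid (\<beta> + \<beta>')"
      using x(7) by (simp add: of_monoid_add)
  qed
qed

lemma fractions_mult:
  assumes U: "ideal_set UNIV U" and x: "x \<in> fractions UNIV d" and y: "y \<in> fractions U e"
  shows "x * y \<in> fractions U (d + e)"
proof -
  from x obtain r s \<alpha> \<beta> where x: "x = to_fract r / to_fract s" "r \<in> R \<alpha>"
    "s \<in> R \<beta>" "s \<notin> P" "d = of_monoid \<alpha> - of_monoid \<beta>" by (rule fractionsE)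
  from y obtain r' s' \<alpha>' \<beta>' where y: "y = to_fract r' / to_fract s'" "r' \<in> R \<alpha>'" "r' \<in> U"
    "s' \<in> R \<beta>'" "s' \<notin> P" "e = of_monoid \<alpha>' - of_monoid \<beta>'" by (rule fractionsE)
  show ?thesis
  proof (rule fractionsI[OF mult_mem[OF x(2) y(2)] _ mult_mem[OF x(3) y(4)]])
    show "r * r' \<in> U" using U y(3) by (auto simp: ideal_set_def)
  qed (use x y in \<open>simp_all add: mult_notin_P of_monoid_add\<close>)
qed

lemma fractions_mono: "x \<in> fractions U d \<Longrightarrow> x \<in> fractions UNIV d"
  unfolding fractions_def by blast

lemma one_fractions: "1 \<in> fractions UNIV 0"
proof -
  obtain s \<sigma> where "s \<in> R \<sigma>" "s \<notin> P" by (rule homogeneous_notin_P)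
  then show ?thesis using zero_P by (intro fractionsI[of s \<sigma> UNIV s \<sigma>]) auto
qed

text \<open>Expanding \<open>r\<close> to \<open>s r / s\<close> with \<open>s\<close> homogeneous outside \<open>P\<close> makes the degree come out without
  reference to the degree of \<open>1\<close>.\<close>
lemma to_fract_fractions:
  assumes "ideal_set UNIV U" "r \<in> R \<alpha>" "r \<in> U"
  shows "to_fract r \<in> fractions U (of_monoid \<alpha>)"
proof -
  obtain s \<sigma> where s: "s \<in> R \<sigma>" "s \<notin> P" by (rule homogeneous_notin_P)
  have "s * r \<in> U" using assms by (auto simp: ideal_set_def)
  moreover have "s \<noteq> 0" using s zero_P by blast
  ultimately show ?thesis using s assms(2)
    by (intro fractionsI[of "s * r" "\<sigma> + \<alpha>" U s \<sigma>]) (auto intro: mult_mem simp: of_monoid_add)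
qed

lemma inverse_fractions:
  assumes "s \<in> R \<beta>" "s \<notin> P"
  shows "\<exists>d. inverse (to_fract s) \<in> fractions UNIV d"
proof -
  have "s \<noteq> 0" using assms zero_P by blast
  then have "inverse (to_fract s) = to_fract s / to_fract (s * s)" by (simp add: field_simps)
  then show ?thesis
    using fractionsI[OF assms(1) UNIV_I mult_mem[OF assms(1,1)] mult_notin_P[OF assms(2,2)]] by blast
qed

definition adjunction_gens :: "'a fract \<Rightarrow> 'a set \<Rightarrow> 'a fract set" where
  "adjunction_gens w U = {y * w ^ n | y n. \<exists>d. y \<in> fractions U d}"

text \<open>For \<open>U = UNIV\<close> this is the ring obtained by adjoining \<open>w\<close> to the localization, and for \<open>U = P\<close> the ideal
  that \<open>P\<close> generates in it. Both are spanned by homogeneous elements when \<open>w\<close> is homogeneous.\<close>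
definition adjunction :: "'a fract \<Rightarrow> 'a set \<Rightarrow> 'a fract set" where
  "adjunction w U = add_span (adjunction_gens w U)"

lemma fractions_adjunction: "y \<in> fractions U d \<Longrightarrow> y \<in> adjunction w U"
  unfolding adjunction_def adjunction_gens_def
  by (rule add_span_base) (force intro: exI[of _ 0])

lemma adjunction_self: "w \<in> adjunction w UNIV"
  unfolding adjunction_def adjunction_gens_def
  by (rule add_span_base) (use one_fractions in \<open>force intro: exI[of _ 1]\<close>)

lemma adjunction_uminus:
  assumes "ideal_set UNIV U" "x \<in> adjunction w U"
  shows "- x \<in> adjunction w U"
  using assms(2) unfolding adjunction_def
proof (rule add_span_uminus)
  fix g assume "g \<in> adjunction_gens w U"
  then obtain y n d where "g = y * w ^ n" "y \<in> fractions U d" by (auto simp: adjunction_gens_def)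
  then have "- g = (- y) * w ^ n" "- y \<in> fractions U d" using fractions_uminus[OF assms(1)] by auto
  then show "- g \<in> adjunction_gens w U" unfolding adjunction_gens_def by blast
qed

lemma adjunction_mult:
  assumes "ideal_set UNIV U" "x \<in> adjunction w UNIV" "y \<in> adjunction w U"
  shows "x * y \<in> adjunction w U"
  using assms(2,3) unfolding adjunction_def
proof (rule add_span_mult)
  fix g h assume "g \<in> adjunction_gens w UNIV" "h \<in> adjunction_gens w U"
  then obtain y n d z m e where "g = y * w ^ n" "y \<in> fractions UNIV d" "h = z * w ^ m" "z \<in> fractions U e"
    by (auto simp: adjunction_gens_def)
  then have "g * h = (y * z) * w ^ (n + m)" "y * z \<in> fractions U (d + e)"
    using fractions_mult[OF assms(1)] by (auto simp: power_add)
  then show "g * h \<in> adjunction_gens w U" unfolding adjunction_gens_def by blast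
qed

lemma subring_adjunction: "subring_set (adjunction w UNIV)"
  unfolding subring_set_def
  using fractions_adjunction[OF one_fractions] adjunction_uminus[OF ideal_set_UNIV]
    adjunction_mult[OF ideal_set_UNIV] by (auto simp: adjunction_def intro: add_span_add)

lemma ideal_adjunction: "ideal_set (adjunction w UNIV) (adjunction w P)"
  unfolding ideal_set_def
proof (intro conjI ballI)
  have "adjunction_gens w P \<subseteq> adjunction_gens w UNIV"
    unfolding adjunction_gens_def using fractions_mono by blast
  then show "adjunction w P \<subseteq> adjunction w UNIV"
    unfolding adjunction_def using add_span_mono by blast
qed (auto simp: adjunction_def intro: add_span.zero add_span_add
      intro: adjunction_mult[OF ideal_P, unfolded adjunction_def])

lemma adjunction_gens_quot_comp:
  assumes "w \<in> quot_comp \<omega>"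
  shows "adjunction_gens w U \<subseteq> (\<Union>d. quot_comp d)"
proof
  fix g assume "g \<in> adjunction_gens w U"
  then obtain y n d where g: "g = y * w ^ n" "y \<in> fractions U d" by (auto simp: adjunction_gens_def)
  obtain e where e: "w ^ n \<in> quot_comp e" using power_mem_quot_comp[OF assms] by blast
  have "g \<in> quot_comp (d + e)"
    unfolding g(1) by (rule QF.mult_mem[OF fractions_quot_comp[OF g(2)] e])
  then show "g \<in> (\<Union>d. quot_comp d)" by blast
qed

lemma adjunction_decomposes:
  assumes "w \<in> quot_comp \<omega>" "x \<in> adjunction w U"
  shows "\<exists>f. decomposes quot_comp f x \<and> (\<forall>d. f d \<in> adjunction w U)"
  using QF.decomposes_in_add_span[OF _ adjunction_gens_quot_comp[OF assms(1)]] assms(2)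
  unfolding adjunction_def by blast

lemma to_fract_adjunction: "to_fract x \<in> adjunction w UNIV"
proof -
  obtain f where f: "decomposes R f x" using decomposes_ex1 by blast
  have "to_fract (f i) \<in> adjunction w UNIV" for i
    using to_fract_fractions[OF ideal_set_UNIV decomposesD(1)[OF f]] fractions_adjunction by blast
  then have "(\<Sum>i | f i \<noteq> 0. to_fract (f i)) \<in> adjunction w UNIV"
    using subring_adjunction[of w] subring_set_zero[OF subring_adjunction[of w]]
    by (intro ideal_set_sum) (auto simp: ideal_set_def subring_set_def)
  then show ?thesis by (simp only: to_fract_decomposes[OF f])
qed

lemma adjunction_subset_quotient_field:
  assumes "w \<in> quot_comp \<omega>"
  shows "adjunction w UNIV \<subseteq> homogeneous_quotient_field R"
proof
  let ?S = "{to_fract a / to_fract b | a b. b \<in> homogeneous_elements R}"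
  have S: "homogeneous_quotient_field R = ?S"
    unfolding homogeneous_quotient_field_def Fract_conv_to_fract ..
  obtain s \<sigma> where "s \<in> R \<sigma>" "s \<notin> P" by (rule homogeneous_notin_P)
  then have s: "s \<in> homogeneous_elements R" using zero_P by (auto simp: homogeneous_elements_def)
  have z: "0 \<in> ?S" by (rule CollectI, rule exI[of _ 0], rule exI[of _ s]) (use s in simp)
  fix x assume "x \<in> adjunction w UNIV"
  then have "x \<in> ?S" unfolding adjunction_def
  proof (rule add_span_least)
    show "adjunction_gens w UNIV \<subseteq> ?S"
    proof
      fix g assume "g \<in> adjunction_gens w UNIV"
      then obtain d where g: "g \<in> quot_comp d" using adjunction_gens_quot_comp[OF assms] by blast
      show "g \<in> ?S"
      proof (cases "g = 0")
        case False
        with g obtain a b \<alpha> \<beta> where "b \<in> R \<beta>" "b \<noteq> 0" "g = to_fract a / to_fract b"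
          by (auto elim: quot_compE)
        then show ?thesis by (auto simp: homogeneous_elements_def)
      qed (use z in simp)
    qed
    show "0 \<in> ?S" by (fact z)
    fix x y assume "x \<in> ?S" "y \<in> ?S"
    then obtain a b a' b' where ab: "x = to_fract a / to_fract b" "b \<in> homogeneous_elements R"
      "y = to_fract a' / to_fract b'" "b' \<in> homogeneous_elements R" by blast
    then have "b * b' \<in> homogeneous_elements R"
      by (force simp: homogeneous_elements_def intro: mult_mem)
    moreover have "x + y = to_fract (a * b' + a' * b) / to_fract (b * b')"
      using ab by (auto simp: field_simps homogeneous_elements_def)
    ultimately show "x + y \<in> ?S" by blast
  qed
  then show "x \<in> homogeneous_quotient_field R" using S by simp
qed

lemma homogeneous_overring_adjunction:
  assumes w: "w \<in> quot_comp \<omega>"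
  shows "homogeneous_overring R (adjunction w UNIV)"
  unfolding homogeneous_overring_def
proof (intro conjI)
  let ?T = "adjunction w UNIV"
  let ?A = "ring_of_type_algebra :: 'a fract ring"
  note T = subring_adjunction[of w]
  interpret A: cring ?A by (rule cring_from_type_algebra)
  have on: "ring_on (UNIV :: 'a fract set) = ?A"
    by (simp add: ring_of_type_algebra_def)
  have inv: "\<ominus>\<^bsub>?A\<^esub> x = - x" for x
    using a_inv_ring_on[OF subring_set_UNIV UNIV_I, of x] unfolding on .
  show "subring ?T ?A"
    by (rule A.subringI)
      (use T inv in \<open>auto simp: subring_set_def ring_of_type_algebra_def\<close>)
  show "range to_fract \<subseteq> ?T" using to_fract_adjunction by blast
  show "?T \<subseteq> homogeneous_quotient_field R" by (rule adjunction_subset_quotient_field) fact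
  show "internal_direct_sum ?T (overring_component R ?T)"
    unfolding internal_direct_sum_def
  proof (intro conjI allI ballI)
    fix d
    show "additive_subgroup (overring_component R ?T d) (ring_on ?T)"
      unfolding additive_subgroup_ring_on_iff[OF T] overring_component_def
      using T subring_set_zero[OF T] QF.zero_mem QF.add_mem QF.uminus_mem
      by (auto simp: subring_set_def)
  next
    fix x assume "x \<in> ?T"
    then obtain f where f: "decomposes quot_comp f x" "\<And>d. f d \<in> ?T"
      using adjunction_decomposes[OF w] by blast
    have iff: "(\<forall>i. g i \<in> overring_component R ?T i) \<and> finite {i. g i \<noteq> 0} \<and>
        x = (\<Sum>i | g i \<noteq> 0. g i) \<longleftrightarrow> decomposes quot_comp g x \<and> (\<forall>d. g d \<in> ?T)" for g
      unfolding decomposes_def overring_component_def by blast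
    show "\<exists>!g. (\<forall>i. g i \<in> overring_component R ?T i) \<and> finite {i. g i \<noteq> 0} \<and>
        x = (\<Sum>i | g i \<noteq> 0. g i)"
      unfolding iff using f QF.decomposes_unique by blast
  qed
qed

text \<open>Let \<open>Q\<close> be a prime ideal above the ideal generated by \<open>P\<close>, and \<open>H\<close> its homogeneous part. The homogeneous
  generators of \<open>P\<close> lie in \<open>Q\<close>, hence in \<open>H\<close>. Conversely, the components of an element of \<open>R\<close> that lies in
  \<open>H\<close> belong to \<open>Q\<close>; none of them is outside \<open>P\<close>, for then it would be a unit of the overring.\<close>
lemma lying_over:
  assumes tl: "torsionless TYPE('g)" and w: "w \<in> quot_comp \<omega>" and one: "1 \<notin> adjunction w P"
  obtains Q where
    "homogeneous_prime_ideal (adjunction w UNIV) (overring_component R (adjunction w UNIV)) Q"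
    "to_fract -` Q = P"
proof -
  let ?T = "adjunction w UNIV"
  note T = subring_adjunction[of w]
  obtain Q where Q: "prime_ideal_set ?T Q" and JQ: "adjunction w P \<subseteq> Q"
    using prime_ideal_above[OF T ideal_adjunction one] by blast
  have Qi: "ideal_set ?T Q" and Q1: "1 \<notin> Q" using Q by (auto simp: prime_ideal_set_def)
  define H where "H = QF.homogeneous_part ?T Q"
  have "homogeneous_prime_ideal ?T (\<lambda>d. ?T \<inter> quot_comp d) H"
    unfolding H_def
    by (rule QF.homogeneous_part_homogeneous_prime[OF _ T _ Q])
      (use quotient_group_torsion_free[OF tl] adjunction_decomposes[OF w] in blast)+
  then have H: "homogeneous_prime_ideal ?T (overring_component R ?T) H"
    unfolding overring_component_def .
  have Hi: "ideal_set ?T H"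
    using H primeideal_ring_on_iff[OF T] by (auto simp: homogeneous_prime_ideal_def prime_ideal_set_def)
  have "x \<in> P" if x: "to_fract x \<in> H" for x
  proof -
    obtain f where f: "decomposes R f x" using decomposes_ex1 by blast
    have fc: "to_fract (f \<alpha>) \<in> quot_comp (of_monoid \<alpha>)" for \<alpha>
      using to_fract_fractions[OF ideal_set_UNIV decomposesD(1)[OF f]] fractions_quot_comp by blast
    let ?S = "{\<alpha>. f \<alpha> \<noteq> 0}"
    have "decomposes quot_comp (\<lambda>d. \<Sum>\<alpha>\<in>?S. if d = of_monoid \<alpha> then to_fract (f \<alpha>) else 0)
        (\<Sum>\<alpha>\<in>?S. to_fract (f \<alpha>))"
      by (intro QF.decomposes_sum QF.decomposes_single fc)
    also have "(\<Sum>\<alpha>\<in>?S. to_fract (f \<alpha>)) = to_fract x"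
      by (rule to_fract_decomposes) (fact f)
    finally have Qc: "(\<Sum>\<alpha>\<in>?S. if d = of_monoid \<alpha> then to_fract (f \<alpha>) else 0) \<in> Q" for d
      using x unfolding H_def QF.homogeneous_part_def by blast
    have "f \<alpha> \<in> P" for \<alpha>
    proof (rule ccontr)
      assume nP: "f \<alpha> \<notin> P"
      then have nz: "f \<alpha> \<noteq> 0" using zero_P by metis
      have "(\<Sum>\<gamma>\<in>?S. if of_monoid \<alpha> = of_monoid \<gamma> then to_fract (f \<gamma>) else 0) = to_fract (f \<alpha>)"
        using nz decomposesD(2)[OF f] by (simp add: of_monoid_inject)
      then have "to_fract (f \<alpha>) \<in> Q" using Qc[of "of_monoid \<alpha>"] by simp
      moreover have "inverse (to_fract (f \<alpha>)) \<in> ?T"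
        using inverse_fractions[OF decomposesD(1)[OF f] nP] fractions_adjunction by blast
      ultimately have "inverse (to_fract (f \<alpha>)) * to_fract (f \<alpha>) \<in> Q"
        using Qi unfolding ideal_set_def by blast
      then show False using nz Q1 by simp
    qed
    then show ?thesis using ideal_set_sum[OF ideal_P, of ?S f] decomposesD(3)[OF f] by simp
  qed
  moreover have "P \<subseteq> to_fract -` H"
  proof -
    obtain G where G: "G \<subseteq> homogeneous_elements R" "P = genideal (ring_on UNIV) G"
      using homogeneous_prime by (auto simp: homogeneous_prime_ideal_def homogeneous_ideal_def)
    interpret U: cring "ring_on (UNIV :: 'a set)" by (rule cring_ring_on) (rule subring_set_UNIV)
    have GP: "G \<subseteq> P" unfolding G(2) by (rule U.genideal_self) simp
    have "ideal_set UNIV (to_fract -` H)"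
      using Hi to_fract_adjunction by (auto simp: ideal_set_def)
    then have "ideal (to_fract -` H) (ring_on UNIV)"
      using ideal_ring_on_iff[OF subring_set_UNIV] by blast
    moreover have "G \<subseteq> to_fract -` H"
    proof
      fix g assume g: "g \<in> G"
      then obtain \<alpha> where "g \<in> R \<alpha>" using G(1) by (auto simp: homogeneous_elements_def)
      then have gf: "to_fract g \<in> fractions P (of_monoid \<alpha>)"
        using to_fract_fractions[OF ideal_P] GP g by blast
      then have "to_fract g \<in> Q" using fractions_adjunction JQ by blast
      then show "g \<in> to_fract -` H"
        using QF.mem_homogeneous_part[OF Qi _ fractions_quot_comp[OF gf]] by (simp add: H_def)
    qed
    ultimately show ?thesis unfolding G(2) by (rule U.genideal_minimal)
  qed
  ultimately have "to_fract -` H = P" by blast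
  with H that show thesis by blast
qed

text \<open>The terms \<open>y w\<^sup>i\<close> of total degree \<open>0\<close> with \<open>y\<close> a homogeneous element of \<open>P R\<^sub>S\<close>. The degree of \<open>y\<close> is left
  existential because \<open>w\<close> and \<open>i\<close> determine it unless the term is zero.\<close>
definition relations :: "'a fract \<Rightarrow> int \<Rightarrow> 'a fract set" where
  "relations w i = {x \<in> quot_comp 0. \<exists>d. x * w powi (- i) \<in> fractions P d}"

lemma zero_fractions: "\<exists>d. 0 \<in> fractions P d"
proof -
  obtain s \<sigma> where "s \<in> R \<sigma>" "s \<notin> P" by (rule homogeneous_notin_P)
  then show ?thesis using zero_P zero_mem by (auto intro!: exI fractionsI[of 0 \<sigma> P s \<sigma>])
qed

text \<open>Being of degree \<open>0\<close>, \<open>x\<close> is \<open>r / s\<close> with \<open>r \<in> P\<close> and \<open>s \<notin> P\<close> homogeneous of the same degree. So \<open>s - r\<close> is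
  again homogeneous and outside \<open>P\<close>, and the inverse of \<open>1 - x\<close> is \<open>s / (s - r)\<close>.\<close>
lemma inverse_one_minus_fraction:
  assumes x: "x \<in> quot_comp 0" "x \<in> fractions P d"
  shows "inverse (1 - x) \<in> fractions UNIV 0"
proof -
  from x(2) obtain r s \<alpha> \<beta> where rs: "x = to_fract r / to_fract s" "r \<in> R \<alpha>" "r \<in> P"
    "s \<in> R \<beta>" "s \<notin> P" "s \<noteq> 0" "d = of_monoid \<alpha> - of_monoid \<beta>" by (rule fractionsE)
  have rb: "r \<in> R \<beta>"
  proof (cases "x = 0")
    case True
    then show ?thesis using rs zero_mem by simp
  next
    case False
    then have "d = 0" using QF.degree_unique x fractions_quot_comp by blast
    then show ?thesis using rs by (simp add: of_monoid_inject)
  qed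
  have "s + - r \<in> R \<beta>" using rb rs by (intro add_mem uminus_mem)
  moreover have nP: "s + - r \<notin> P"
  proof
    assume "s + - r \<in> P"
    then have "(s + - r) + r \<in> P" using ideal_P rs(3) unfolding ideal_set_def by blast
    then show False using rs by simp
  qed
  moreover have "1 - x = to_fract (s + - r) / to_fract s"
    using rs(1,6) by (simp add: diff_divide_distrib)
  then have "inverse (1 - x) = to_fract s / to_fract (s + - r)"
    by (simp only: inverse_divide)
  ultimately show ?thesis using rs(4) by (intro fractionsI[of s \<beta> UNIV "s + - r" \<beta>]) auto
qed

lemma relation_family_relations:
  assumes w: "w \<in> quot_comp \<omega>" "w \<noteq> 0"
  shows "relation_family (relations w)"
proof
  fix i
  show z: "0 \<in> relations w i"
    using zero_fractions zero_mem_quot_comp by (simp add: relations_def)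
  fix x y assume xy: "x \<in> relations w i" "y \<in> relations w i"
  show "x + y \<in> relations w i"
  proof (cases "x = 0 \<or> y = 0")
    case False
    obtain e where e: "w powi (- i) \<in> quot_comp e" using power_int_mem_quot_comp[OF w(1)] by blast
    \<comment> \<open>Both summands have the same degree after division by \<open>w\<close> to the power \<open>i\<close>, namely that of the inverse power.\<close>
    have "t * w powi (- i) \<in> fractions P e" if t: "t \<in> relations w i" "t \<noteq> 0" for t
    proof -
      obtain d where d: "t * w powi (- i) \<in> fractions P d" using t by (auto simp: relations_def)
      moreover have "t * w powi (- i) \<in> quot_comp e"
        using QF.mult_mem[OF _ e, of t 0] t by (simp add: relations_def)
      moreover have "t * w powi (- i) \<noteq> 0" using t w by simp
      ultimately have "d = e" using QF.degree_unique fractions_quot_comp by blast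
      with d show ?thesis by simp
    qed
    then have "x * w powi (- i) + y * w powi (- i) \<in> fractions P e"
      using False xy by (intro fractions_add[OF ideal_P]) auto
    then show ?thesis using xy QF.add_mem by (auto simp: relations_def distrib_right)
  qed (use xy in auto)
next
  fix x y i j assume xy: "x \<in> relations w i" "y \<in> relations w j"
  then obtain d e where "x * w powi (- i) \<in> fractions P d" "y * w powi (- j) \<in> fractions P e"
    by (auto simp: relations_def)
  then have "(x * w powi (- i)) * (y * w powi (- j)) \<in> fractions P (d + e)"
    by (intro fractions_mult[OF ideal_P fractions_mono])
  also have "(x * w powi (- i)) * (y * w powi (- j)) = (x * y) * w powi (- (i + j))"
    using w(2) by (simp add: power_int_add power_int_diff power_int_minus field_simps)
  finally show "x * y \<in> relations w (i + j)"
    using xy QF.mult_mem[of x 0 y 0] by (auto simp: relations_def)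
next
  show "1 \<notin> relations w 0"
  proof
    assume "1 \<in> relations w 0"
    then obtain d where "1 \<in> fractions P d" by (auto simp: relations_def)
    then show False by (rule fractionsE) (auto simp: field_simps)
  qed
next
  fix x y j assume x: "x \<in> relations w 0" and y: "y \<in> relations w j"
  from x have inv: "inverse (1 - x) \<in> fractions UNIV 0"
    using inverse_one_minus_fraction by (auto simp: relations_def)
  obtain e where "y * w powi (- j) \<in> fractions P e" using y by (auto simp: relations_def)
  from fractions_mult[OF ideal_P inv this]
  have "y / (1 - x) * w powi (- j) \<in> fractions P (0 + e)"
    by (simp add: divide_inverse mult_ac)
  moreover have "y / (1 - x) \<in> quot_comp 0"
    using QF.mult_mem[OF _ fractions_quot_comp[OF inv], of y 0] y
    by (simp add: relations_def divide_inverse)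
  ultimately show "y / (1 - x) \<in> relations w j" by (auto simp: relations_def)
qed

lemma relations_inverse: "relations (inverse w) i = relations w (- i)"
  by (simp add: relations_def power_int_minus power_int_inverse)

text \<open>Since \<open>1\<close> is homogeneous of degree \<open>0\<close>, only the degree-\<open>0\<close> generators in an expression of it matter, and
  these are terms \<open>y w\<^sup>n\<close> in \<open>relations w n\<close>.\<close>
lemma unit_relation:
  assumes w: "w \<in> quot_comp \<omega>" "w \<noteq> 0" and one: "1 \<in> adjunction w P"
  shows "1 \<in> add_span (\<Union>n. relations w (int n))"
proof -
  let ?E = "add_span (\<Union>n. relations w (int n))"
  have "\<exists>f. decomposes quot_comp f x \<and> f 0 \<in> ?E" if "x \<in> add_span (adjunction_gens w P)" for x
    using that
  proof (induction rule: add_span.induct)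
    case zero
    show ?case using QF.decomposes_zero add_span.zero by blast
  next
    case (step g x)
    then obtain f where f: "decomposes quot_comp f x" "f 0 \<in> ?E" by blast
    obtain y n d where g: "g = y * w ^ n" "y \<in> fractions P d"
      using step(1) by (auto simp: adjunction_gens_def)
    obtain e where "g \<in> quot_comp e" using adjunction_gens_quot_comp[OF w(1)] step(1) by blast
    note dec = QF.decomposes_add[OF QF.decomposes_single[OF this] f(1)]
    have "g * w powi (- int n) = y"
      using w(2) by (simp add: g(1) power_int_minus)
    then have "g \<in> relations w (int n)" if "e = 0"
      using that \<open>g \<in> quot_comp e\<close> g(2) by (auto simp: relations_def)
    then have "(if 0 = e then g else 0) + f 0 \<in> ?E"
      using f(2) by (auto intro: add_span.step)
    with dec show ?case by (intro exI[of _ "\<lambda>j. (if j = e then g else 0) + f j"]) blast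
  qed
  then obtain f where "decomposes quot_comp f 1" "f 0 \<in> ?E"
    using one unfolding adjunction_def by blast
  then show ?thesis
    using QF.decomposes_unique[OF _ QF.decomposes_single[OF QF.one_mem]] by fastforce
qed

lemma survives_in_one_direction:
  assumes w: "w \<in> quot_comp \<omega>" "w \<noteq> 0"
  shows "1 \<notin> adjunction w P \<or> 1 \<notin> adjunction (inverse w) P"
proof (rule ccontr)
  assume "\<not> ?thesis"
  then have "1 \<in> add_span (\<Union>n. relations w (int n))"
    "1 \<in> add_span (\<Union>n. relations w (- int n))"
    using unit_relation[OF w] unit_relation[OF inverse_mem_quot_comp[OF w(1)]] w(2)
    by (auto simp: relations_inverse)
  then show False using no_opposite_relations[OF relation_family_relations[OF w]] by blast
qed

text \<open>Going-down yields a prime \<open>Q\<^sub>0\<close> of the overring over \<open>P\<^sub>0\<close>; it contains \<open>b\<close>, hence \<open>a = (a / b) b\<close>.\<close>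
lemma going_down_fails:
  assumes tl: "torsionless TYPE('g)" and gGD: "gGD_domain R"
    and P0: "homogeneous_prime_ideal UNIV R P\<^sub>0" "P\<^sub>0 \<subseteq> P"
    and ab: "a \<in> R \<alpha>" "b \<in> R \<beta>" "b \<noteq> 0" "a \<notin> P\<^sub>0" "b \<in> P\<^sub>0"
    and one: "1 \<notin> adjunction (to_fract a / to_fract b) P"
  shows False
proof -
  let ?w = "to_fract a / to_fract b"
  let ?T = "adjunction ?w UNIV"
  have w: "?w \<in> quot_comp (of_monoid \<alpha> - of_monoid \<beta>)"
    using ab by (intro quot_compI) auto
  obtain Q where "homogeneous_prime_ideal ?T (overring_component R ?T) Q" "to_fract -` Q = P"
    using lying_over[OF tl w one] by blast
  moreover have "satisfies_gGD R ?T"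
    using gGD homogeneous_overring_adjunction[OF w] by (simp add: gGD_domain_def)
  ultimately obtain Q\<^sub>0 where Q0: "homogeneous_prime_ideal ?T (overring_component R ?T) Q\<^sub>0"
    "to_fract -` Q\<^sub>0 = P\<^sub>0"
    using P0 homogeneous_prime unfolding satisfies_gGD_def by blast
  have "ideal_set ?T Q\<^sub>0"
    using Q0(1) primeideal_ring_on_iff[OF subring_adjunction]
    by (auto simp: homogeneous_prime_ideal_def prime_ideal_set_def)
  moreover have "to_fract b \<in> Q\<^sub>0" using Q0(2) ab(5) by blast
  ultimately have "?w * to_fract b \<in> Q\<^sub>0"
    using adjunction_self[of ?w] unfolding ideal_set_def by blast
  then have "to_fract a \<in> Q\<^sub>0" using ab(3) by simp
  then show False using Q0(2) ab(4) by blast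
qed

end

text \<open>Otherwise \<open>P'\<close> would contain the homogeneous generators of \<open>P\<close>.\<close>
lemma homogeneous_element_in_difference:
  assumes P: "homogeneous_prime_ideal UNIV R P" "homogeneous_prime_ideal UNIV R P'" "\<not> P \<subseteq> P'"
  obtains a \<alpha> where "a \<in> R \<alpha>" "a \<noteq> 0" "a \<in> P" "a \<notin> P'"
proof -
  interpret U: cring "ring_on (UNIV :: 'a set)" by (rule cring_ring_on) (rule subring_set_UNIV)
  obtain G where G: "G \<subseteq> homogeneous_elements R" "P = genideal (ring_on UNIV) G"
    using P by (auto simp: homogeneous_prime_ideal_def homogeneous_ideal_def)
  have "ideal P' (ring_on UNIV)"
    using P(2) by (auto simp: homogeneous_prime_ideal_def primeideal_def)
  then have "\<not> G \<subseteq> P'" using P(3) U.genideal_minimal unfolding G(2) by blast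
  moreover have "G \<subseteq> P" unfolding G(2) by (rule U.genideal_self) simp
  ultimately show thesis using G(1) that by (force simp: homogeneous_elements_def)
qed

theorem proposition3p3:
  fixes R :: "'g::cancel_comm_monoid_add \<Rightarrow> 'a::idom set"
  assumes "\<exists>\<gamma>::'g. \<gamma> \<noteq> 0"
    and "torsionless TYPE('g)"
    and "graded_domain R"
    and "gGD_domain R"
  shows "g_treed R"
  unfolding g_treed_def
proof
  assume "\<exists>P P\<^sub>1 P\<^sub>2. homogeneous_prime_ideal UNIV R P \<and>
          homogeneous_prime_ideal UNIV R P\<^sub>1 \<and> homogeneous_prime_ideal UNIV R P\<^sub>2 \<and>
          P\<^sub>1 \<subseteq> P \<and> P\<^sub>2 \<subseteq> P \<and> \<not> P\<^sub>1 \<subseteq> P\<^sub>2 \<and> \<not> P\<^sub>2 \<subseteq> P\<^sub>1"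
  then obtain P P\<^sub>1 P\<^sub>2 where P: "homogeneous_prime_ideal UNIV R P"
    and P1: "homogeneous_prime_ideal UNIV R P\<^sub>1" "P\<^sub>1 \<subseteq> P"
    and P2: "homogeneous_prime_ideal UNIV R P\<^sub>2" "P\<^sub>2 \<subseteq> P"
    and incomparable: "\<not> P\<^sub>1 \<subseteq> P\<^sub>2" "\<not> P\<^sub>2 \<subseteq> P\<^sub>1" by blast
  interpret graded_prime R P by standard (fact assms(3), fact P)
  obtain a \<alpha> where a: "a \<in> R \<alpha>" "a \<noteq> 0" "a \<in> P\<^sub>1" "a \<notin> P\<^sub>2"
    using homogeneous_element_in_difference[OF P1(1) P2(1) incomparable(1)] .
  obtain b \<beta> where b: "b \<in> R \<beta>" "b \<noteq> 0" "b \<in> P\<^sub>2" "b \<notin> P\<^sub>1"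
    using homogeneous_element_in_difference[OF P2(1) P1(1) incomparable(2)] .
  let ?w = "to_fract a / to_fract b"
  have "?w \<in> quot_comp (of_monoid \<alpha> - of_monoid \<beta>)" "?w \<noteq> 0"
    using a b by (auto intro: quot_compI)
  then consider "1 \<notin> adjunction ?w P" | "1 \<notin> adjunction (to_fract b / to_fract a) P"
    using survives_in_one_direction by fastforce
  then show False
  proof cases
    case 1
    then show ?thesis using going_down_fails[OF assms(2,4) P2 a(1) b(1,2) a(4) b(3)] by blast
  next
    case 2
    then show ?thesis using going_down_fails[OF assms(2,4) P1 b(1) a(1,2) b(4) a(3)] by blast
  qed
qed

end
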